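(* Let $L(n)$ denote the maximum CF-chromatic number $\chi_{\mathrm{cf}}(G)$ over all intersection graphs $G$ of families of at most $n$ grounded L-shapes. Then $\Omega(\log n)\le L(n)\le O(\log^3 n)$.
   Context: An L-shape is a curve consisting of a vertical segment and a horizontal segment forming the letter L, i.e. a set of the form $\{x\}\times[y_0,y_1]\ \cup\ [x,x']\times\{y_0\}$ with $y_0<y_1$, $x<x'$. Fix a horizontal line $H$ (the baseline). An L-shape is grounded if it lies in the closed lower halfplane bounded by $H$ and has exactly one endpoint (the top of its vertical segment) on $H$. The intersection graph of a family of sets has the sets as vertices, two adjacent iff they intersect. For a graph $G=(V,E)$ and $v\in V$, $N_G(v)=\{u:\{u,v\}\in E\}$. A CF-coloring of $G$ is a map $c:V\to\mathbb{N}$ such that for every $v$ with $N_G(v)\ne\emptyset$ some color appears exactly once in $N_G(v)$ (vertices with empty neighborhood impose no condition); $\chi_{\mathrm{cf}}(G)$ is the minimum number of colors in such a coloring. *)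

theory Defs
  imports Complex_Main "HOL-Library.Landau_Symbols"
begin

definition l_shape :: "real \<Rightarrow> real \<Rightarrow> real \<Rightarrow> real \<Rightarrow> (real \<times> real) set" where
  "l_shape x y0 y1 x' = {x} \<times> {y0..y1} \<union> {x..x'} \<times> {y0}"

definition baseline :: "real \<Rightarrow> (real \<times> real) set" where
  "baseline h = UNIV \<times> {h}"

definition lower_halfplane :: "real \<Rightarrow> (real \<times> real) set" where
  "lower_halfplane h = UNIV \<times> {..h}"

text \<open>The two endpoints of the curve are \<open>(x, y1)\<close>, the top of the vertical segment, and
  \<open>(x', y0)\<close>, the right end of the horizontal segment.\<close>

definition grounded_L_shape :: "real \<Rightarrow> (real \<times> real) set \<Rightarrow> bool" where
  "grounded_L_shape h S \<longleftrightarrow>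
     (\<exists>x y0 y1 x'. y0 < y1 \<and> x < x' \<and> S = l_shape x y0 y1 x' \<and>
        S \<subseteq> lower_halfplane h \<and> (x, y1) \<in> baseline h \<and> (x', y0) \<notin> baseline h)"

text \<open>A graph is given by its vertex set \<open>V\<close> and its set \<open>E\<close> of two-element edges. The
  intersection graph of \<open>F\<close> has vertex set \<open>F\<close>.\<close>

definition intersection_edges :: "'a set set \<Rightarrow> 'a set set set" where
  "intersection_edges F = {{A, B} | A B. A \<in> F \<and> B \<in> F \<and> A \<noteq> B \<and> A \<inter> B \<noteq> {}}"

definition neighborhood :: "'v set set \<Rightarrow> 'v \<Rightarrow> 'v set" where
  "neighborhood E v = {u. {u, v} \<in> E}"

definition cf_coloring :: "'v set \<Rightarrow> 'v set set \<Rightarrow> ('v \<Rightarrow> nat) \<Rightarrow> bool" where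
  "cf_coloring V E c \<longleftrightarrow>
     (\<forall>v\<in>V. neighborhood E v \<noteq> {} \<longrightarrow> (\<exists>k. \<exists>!u. u \<in> neighborhood E v \<and> c u = k))"

definition cf_chromatic_number :: "'v set \<Rightarrow> 'v set set \<Rightarrow> nat" where
  "cf_chromatic_number V E = (LEAST k. \<exists>c. cf_coloring V E c \<and> card (c ` V) = k)"

definition grounded_L_cf_values :: "real \<Rightarrow> nat \<Rightarrow> nat set" where
  "grounded_L_cf_values h n =
     {cf_chromatic_number F (intersection_edges F) | F.
        finite F \<and> card F \<le> n \<and> (\<forall>S\<in>F. grounded_L_shape h S)}"

definition max_cf_grounded_L :: "real \<Rightarrow> nat \<Rightarrow> nat" where
  "max_cf_grounded_L h n = Max (grounded_L_cf_values h n)"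

text \<open>The minimum and the maximum above are attained: a finite graph has a CF-coloring (any
  injective one), so the values over families of at most \<open>n\<close> shapes are bounded by \<open>n\<close>.\<close>

lemma neighborhood_intersection_edges:
  "neighborhood (intersection_edges F) A = {B \<in> F. A \<in> F \<and> A \<noteq> B \<and> A \<inter> B \<noteq> {}}"
  unfolding neighborhood_def intersection_edges_def by (auto simp: doubleton_eq_iff)

lemma cf_coloring_inj:
  assumes "inj_on c F"
  shows "cf_coloring F (intersection_edges F) c"
  unfolding cf_coloring_def
proof (intro ballI impI)
  fix v assume "neighborhood (intersection_edges F) v \<noteq> {}"
  then obtain u where u: "u \<in> neighborhood (intersection_edges F) v" by blast
  have "w = u" if "w \<in> neighborhood (intersection_edges F) v" "c w = c u" for w
    using that u assms by (auto simp: neighborhood_intersection_edges inj_on_def)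
  with u show "\<exists>k. \<exists>!u. u \<in> neighborhood (intersection_edges F) v \<and> c u = k" by blast
qed

lemma cf_chromatic_number_attained:
  assumes "finite F"
  obtains c where "cf_coloring F (intersection_edges F) c"
    and "card (c ` F) = cf_chromatic_number F (intersection_edges F)"
proof -
  obtain c :: "'a set \<Rightarrow> nat" where "inj_on c F"
    using assms finite_imp_inj_to_nat_seg by blast
  then have "\<exists>k c. cf_coloring F (intersection_edges F) c \<and> card (c ` F) = k"
    using cf_coloring_inj by blast
  from LeastI_ex[OF this] show ?thesis
    using that unfolding cf_chromatic_number_def by blast
qed

lemma cf_chromatic_number_le:
  assumes "cf_coloring V E c"
  shows "cf_chromatic_number V E \<le> card (c ` V)"
  unfolding cf_chromatic_number_def by (rule Least_le) (use assms in blast)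

lemma grounded_L_cf_values_le: "k \<in> grounded_L_cf_values h n \<Longrightarrow> k \<le> n"
proof -
  assume "k \<in> grounded_L_cf_values h n"
  then obtain F :: "(real \<times> real) set set"
    where F: "k = cf_chromatic_number F (intersection_edges F)" "finite F" "card F \<le> n"
    unfolding grounded_L_cf_values_def by blast
  obtain c :: "(real \<times> real) set \<Rightarrow> nat" where "inj_on c F"
    using F(2) finite_imp_inj_to_nat_seg by blast
  then have "k \<le> card (c ` F)"
    using F(1) cf_chromatic_number_le cf_coloring_inj by blast
  also have "\<dots> \<le> n" using F(2,3) card_image_le[of F c] by linarith
  finally show "k \<le> n" .
qed

lemma finite_grounded_L_cf_values: "finite (grounded_L_cf_values h n)"
  by (rule finite_subset[of _ "{..n}"]) (auto dest: grounded_L_cf_values_le)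

lemma grounded_L_cf_values_nonempty: "grounded_L_cf_values h n \<noteq> {}"
  unfolding grounded_L_cf_values_def by (auto intro!: exI[of _ "{}"])

lemma grounded_L_shape_iff:
  "grounded_L_shape h S \<longleftrightarrow> (\<exists>x y0 x'. y0 < h \<and> x < x' \<and> S = l_shape x y0 h x')"
proof -
  have "l_shape x y0 h x' \<subseteq> lower_halfplane h" if "y0 < h" for x y0 x'
    using that by (auto simp: l_shape_def lower_halfplane_def)
  then show ?thesis
    unfolding grounded_L_shape_def baseline_def by auto blast
qed

end

theory Submission
  imports Defs "HOL-Library.Product_Lexorder"
begin

text \<open>
  Up to the order of the corners along each axis, a shape is an integer interval \<open>[X u, R u]\<close> with a
  depth \<open>D u\<close>, and \<open>u\<close>, \<open>v\<close> meet iff one of them hits the other: \<open>X u < X v \<le> R u\<close> and \<open>D u < D v\<close>.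

  Upper bound. Each interval is placed at the node of the dyadic tree whose midpoint it contains; this
  gives \<open>O(log n)\<close> levels. A vertex is bad if all its neighbours have a smaller level; the bad vertices
  are pairwise non-adjacent. Choose a minimal set meeting, for every bad \<open>v\<close>, the set of neighbours
  that hit \<open>v\<close> or are hit by \<open>v\<close> to the left of its midpoint. Each chosen vertex has a private bad
  vertex, and two chosen vertices of equal level whose private vertices have equal level and the same
  relative position are not adjacent. Sorting the vertices by these data gives \<open>O(log\<^sup>2 n)\<close>
  classes such that every vertex \<open>v\<close> has a class in which it has a neighbour and in which it either
  is only hit, or only hits, or is bad while the class is independent. Inside a class the pairs that
  occur as two-element neighbourhoods of this kind form a union of four noncrossing, hence
  3-colourable, graphs, so \<open>O(log n)\<close> colours suffice per class.

  Lower bound. Bars over all dyadic blocks of \<open>2\<^sup>H\<close> posts can be drawn without meeting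
  each other. The unique colour of a block is missing from one of its halves, so a block of \<open>2\<^sup>l\<close>
  posts needs \<open>l + 1\<close> colours.
\<close>

section \<open>Noncrossing graphs\<close>

text \<open>Among the edges passing over some vertex of \<open>Q\<close> take one of least key
  length, and a vertex \<open>w\<close> strictly under it. An edge at \<open>w\<close> that leaves
  the span crosses it; one that stays inside is shorter and so passes over nothing.\<close>

lemma noncrossing_locally_short_vertex:
  fixes k :: "'a \<Rightarrow> nat"
  assumes "Q \<noteq> {}"
    and noncrossing: "\<And>a a' b b'. \<lbrakk>a \<in> Q; a' \<in> Q; b \<in> Q; b' \<in> Q; k a < k a'; k a' < k b; k b < k b';
      E a b; E a' b'\<rbrakk> \<Longrightarrow> False"
  shows "\<exists>z\<in>Q. (\<forall>y\<in>Q. k y < k z \<longrightarrow> E y z \<longrightarrow> (\<forall>w\<in>Q. \<not> (k y < k w \<and> k w < k z))) \<and>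
                (\<forall>y\<in>Q. k z < k y \<longrightarrow> E z y \<longrightarrow> (\<forall>w\<in>Q. \<not> (k z < k w \<and> k w < k y)))"
proof -
  define P where "P d \<longleftrightarrow> (\<exists>a\<in>Q. \<exists>b\<in>Q. \<exists>w\<in>Q. k a < k w \<and> k w < k b \<and> E a b \<and> d = k b - k a)" for d
  show ?thesis
  proof (cases "\<exists>d. P d")
    case False
    then show ?thesis using \<open>Q \<noteq> {}\<close> unfolding P_def by blast
  next
    case True
    define d where "d = (LEAST d. P d)"
    have "P d" using True unfolding d_def by (rule LeastI_ex)
    have least: "d \<le> d'" if "P d'" for d' using that unfolding d_def by (rule Least_le)
    obtain a b w where abw: "a \<in> Q" "b \<in> Q" "w \<in> Q" "k a < k w" "k w < k b" "E a b" "d = k b - k a"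
      using \<open>P d\<close> unfolding P_def by blast
    have False if "y \<in> Q" "k y < k w" "E y w" "t \<in> Q" "k y < k t" "k t < k w" for y t
    proof (cases "k y < k a")
      case True
      then show False using noncrossing[of y a w b] that abw by blast
    next
      case False
      have "P (k w - k y)" unfolding P_def using that abw by blast
      then show False using least[of "k w - k y"] False abw that by linarith
    qed
    moreover have False if "y \<in> Q" "k w < k y" "E w y" "t \<in> Q" "k w < k t" "k t < k y" for y t
    proof (cases "k b < k y")
      case True
      then show False using noncrossing[of a w b y] that abw by blast
    next
      case False
      have "P (k y - k w)" unfolding P_def using that abw by blast
      then show False using least[of "k y - k w"] False abw that by linarith
    qed
    ultimately show ?thesis using abw(3) by blast
  qed
qed

text \<open>Induction by removing the vertex \<open>z\<close> of the previous lemma: it is adjacent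
  at most to its predecessor and its successor in key order, so one of three colours stays
  free.\<close>

lemma noncrossing_three_coloring:
  fixes k :: "'a \<Rightarrow> nat"
  assumes "finite Q" "inj_on k Q"
    and "\<And>a a' b b'. \<lbrakk>a \<in> Q; a' \<in> Q; b \<in> Q; b' \<in> Q; k a < k a'; k a' < k b; k b < k b';
      E a b; E a' b'\<rbrakk> \<Longrightarrow> False"
  shows "\<exists>f :: 'a \<Rightarrow> nat. (\<forall>a. f a < 3) \<and> (\<forall>a\<in>Q. \<forall>b\<in>Q. k a < k b \<longrightarrow> E a b \<longrightarrow> f a \<noteq> f b)"
  using assms
proof (induction Q rule: finite_psubset_induct)
  case (psubset Q)
  show ?case
  proof (cases "Q = {}")
    case True
    then show ?thesis by (auto intro: exI[of _ "\<lambda>_. 0"])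
  next
    case False
    have "\<exists>z\<in>Q. (\<forall>y\<in>Q. k y < k z \<longrightarrow> E y z \<longrightarrow> (\<forall>w\<in>Q. \<not> (k y < k w \<and> k w < k z))) \<and>
                (\<forall>y\<in>Q. k z < k y \<longrightarrow> E z y \<longrightarrow> (\<forall>w\<in>Q. \<not> (k z < k w \<and> k w < k y)))"
      using False psubset.prems(2) by (rule noncrossing_locally_short_vertex)
    then obtain z where z: "z \<in> Q"
      and lo: "\<And>y w. \<lbrakk>y \<in> Q; k y < k z; E y z; w \<in> Q\<rbrakk> \<Longrightarrow> \<not> (k y < k w \<and> k w < k z)"
      and hi: "\<And>y w. \<lbrakk>y \<in> Q; k z < k y; E z y; w \<in> Q\<rbrakk> \<Longrightarrow> \<not> (k z < k w \<and> k w < k y)"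
      by blast
    have "\<exists>f :: 'a \<Rightarrow> nat. (\<forall>a. f a < 3) \<and>
        (\<forall>a\<in>Q - {z}. \<forall>b\<in>Q - {z}. k a < k b \<longrightarrow> E a b \<longrightarrow> f a \<noteq> f b)"
    proof (rule psubset.IH)
      show "Q - {z} \<subset> Q" using z by blast
      show "inj_on k (Q - {z})" using psubset.prems(1) by (rule inj_on_subset) blast
      show False if "a \<in> Q - {z}" "a' \<in> Q - {z}" "b \<in> Q - {z}" "b' \<in> Q - {z}"
        "k a < k a'" "k a' < k b" "k b < k b'" "E a b" "E a' b'" for a a' b b'
        using psubset.prems(2)[of a a' b b'] that by auto
    qed
    then obtain f :: "'a \<Rightarrow> nat" where f: "\<And>a. f a < 3"
      "\<And>a b. \<lbrakk>a \<in> Q - {z}; b \<in> Q - {z}; k a < k b; E a b\<rbrakk> \<Longrightarrow> f a \<noteq> f b"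
      by blast
    have "\<exists>p. \<forall>y\<in>Q. k y < k z \<longrightarrow> E y z \<longrightarrow> y = p"
      using lo psubset.prems(1) by (metis inj_onD nat_neq_iff)
    then obtain p where p: "\<And>y. \<lbrakk>y \<in> Q; k y < k z; E y z\<rbrakk> \<Longrightarrow> y = p" by blast
    have "\<exists>q. \<forall>y\<in>Q. k z < k y \<longrightarrow> E z y \<longrightarrow> y = q"
      using hi psubset.prems(1) by (metis inj_onD nat_neq_iff)
    then obtain q where q: "\<And>y. \<lbrakk>y \<in> Q; k z < k y; E z y\<rbrakk> \<Longrightarrow> y = q" by blast
    have "\<exists>c<3. c \<noteq> f p \<and> c \<noteq> f q"
    proof -
      have "card {f p, f q} \<le> 2" by (simp add: card_insert_le_m1)
      then have "\<not> {..<3} \<subseteq> {f p, f q}"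
        using card_mono[of "{f p, f q}" "{..<3}"] by auto
      then show ?thesis by blast
    qed
    then obtain c where c: "c < 3" "c \<noteq> f p" "c \<noteq> f q" by blast
    have "(f(z := c)) a \<noteq> (f(z := c)) b" if "a \<in> Q" "b \<in> Q" "k a < k b" "E a b" for a b
      using f(2)[of a b] p[of a] q[of b] c that by auto
    then show ?thesis using f(1) c(1) by (intro exI[of _ "f(z := c)"]) auto
  qed
qed

definition visible :: "'a set \<Rightarrow> ('a \<Rightarrow> nat) \<Rightarrow> ('a \<Rightarrow> int) \<Rightarrow> 'a \<Rightarrow> 'a \<Rightarrow> bool" where
  "visible Q k g a b \<longleftrightarrow> (\<forall>z\<in>Q. k a < k z \<and> k z < k b \<longrightarrow> g z < min (g a) (g b))"

text \<open>Visible pairs \<open>a\<close>, \<open>b\<close> and \<open>a'\<close>,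
  \<open>b'\<close> that cross in the key order \<open>a\<close>, \<open>a'\<close>,
  \<open>b\<close>, \<open>b'\<close> would give \<open>g a' < g b\<close> from the first and
  \<open>g b < g a'\<close> from the second.\<close>

lemma visible_three_coloring:
  assumes "finite Q" "inj_on k Q"
  shows "\<exists>f :: 'a \<Rightarrow> nat. (\<forall>a. f a < 3) \<and> (\<forall>a\<in>Q. \<forall>b\<in>Q. k a < k b \<longrightarrow> visible Q k g a b \<longrightarrow> f a \<noteq> f b)"
  using assms by (rule noncrossing_three_coloring) (fastforce simp: visible_def)

text \<open>Supplies two members of a hyperedge that are consecutive in key order, so that whatever
  lies strictly between them is outside the hyperedge.\<close>

lemma two_lowest_keys:
  fixes k :: "'a \<Rightarrow> nat"
  assumes "finite h" "inj_on k h" "2 \<le> card h"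
  obtains a b where "a \<in> h" "b \<in> h" "k a < k b" "\<And>z. z \<in> h \<Longrightarrow> \<not> (k a < k z \<and> k z < k b)"
proof -
  have "h \<noteq> {}" using assms by auto
  then obtain a where a: "a \<in> h" "\<And>z. z \<in> h \<Longrightarrow> k a \<le> k z"
    using arg_min_if_finite[OF assms(1), of k] by (metis linorder_not_le)
  have "card (h - {a}) \<ge> 1" using assms a by simp
  then have "h - {a} \<noteq> {}" by (metis card.empty not_one_le_zero)
  then obtain b where b: "b \<in> h - {a}" "\<And>z. z \<in> h - {a} \<Longrightarrow> k b \<le> k z"
    using arg_min_if_finite[of "h - {a}" k] assms(1) by (metis finite_Diff linorder_not_le)
  have "k a < k b" using a b assms(2) by (metis DiffD1 DiffD2 inj_onD le_neq_implies_less singletonI)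
  moreover have "\<not> (k a < k z \<and> k z < k b)" if "z \<in> h" for z
    using b(2)[of z] that by force
  ultimately show ?thesis using that a b by blast
qed

section \<open>Conflict-free colouring by peeling off independent parts\<close>

lemma large_fibre:
  assumes "finite Q" "finite C" "F ` Q \<subseteq> C" "C \<noteq> {}"
  shows "\<exists>c\<in>C. card Q \<le> card C * card {q \<in> Q. F q = c}"
proof (rule ccontr)
  assume "\<not> ?thesis"
  then have less: "card C * card {q \<in> Q. F q = c} < card Q" if "c \<in> C" for c
    using that by force
  have "card Q = (\<Sum>c\<in>C. card {q \<in> Q. F q = c})"
    using sum.group[OF assms(1,2,3), of "\<lambda>_. 1::nat"] by simp
  then have "card C * card Q = (\<Sum>c\<in>C. card C * card {q \<in> Q. F q = c})"
    by (simp add: sum_distrib_left)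
  also have "\<dots> < (\<Sum>c\<in>C. card Q)"
    using assms(2,4) less by (intro sum_strict_mono) auto
  finally show False by simp
qed

text \<open>Repeatedly split off an independent part and give it a fresh colour: the colour of a hyperedge
  that is split off last occurs exactly once in it.\<close>

lemma conflict_free_by_independent_parts:
  fixes N :: nat
  assumes "finite Y" "N > 0" "real (card Y) * (1 - 1 / real N) ^ K < 1"
    and "\<And>Q. \<lbrakk>Q \<subseteq> Y; Q \<noteq> {}\<rbrakk> \<Longrightarrow>
      \<exists>I\<subseteq>Q. card Q \<le> N * card I \<and> (\<forall>h\<in>\<H>. h \<inter> Q \<subseteq> I \<longrightarrow> card (h \<inter> Q) \<le> 1)"
  shows "\<exists>c :: 'a \<Rightarrow> nat. (\<forall>y\<in>Y. c y < K) \<and>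
    (\<forall>h\<in>\<H>. h \<inter> Y \<noteq> {} \<longrightarrow> (\<exists>k. \<exists>!u. u \<in> h \<inter> Y \<and> c u = k))"
  using assms
proof (induction K arbitrary: Y)
  case 0
  then have "Y = {}" by simp
  then show ?case by simp
next
  case (Suc K)
  show ?case
  proof (cases "Y = {}")
    case False
    then obtain I where I: "I \<subseteq> Y" "card Y \<le> N * card I"
      "\<And>h. \<lbrakk>h \<in> \<H>; h \<inter> Y \<subseteq> I\<rbrakk> \<Longrightarrow> card (h \<inter> Y) \<le> 1"
      using Suc.prems(4)[of Y] by blast
    have finI: "finite I" using I(1) Suc.prems(1) finite_subset by blast
    \<comment> \<open>Since \<open>card Y \<le> N * card I\<close>, a round shrinks the set at least
      by the factor \<open>1 - 1 / N\<close>, so the size hypothesis passes from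
      \<open>Suc K\<close> to \<open>K\<close> rounds.\<close>
    have "real (card (Y - I)) = real (card Y) - real (card I)"
      using I(1) finI Suc.prems(1) by (simp add: card_Diff_subset card_mono of_nat_diff)
    also have "\<dots> \<le> real (card Y) * (1 - 1 / real N)"
    proof -
      have "real (card Y) \<le> real N * real (card I)" using I(2) by (metis of_nat_le_iff of_nat_mult)
      then show ?thesis using Suc.prems(2) by (simp add: field_simps)
    qed
    finally have "real (card (Y - I)) * (1 - 1 / real N) ^ K
        \<le> real (card Y) * (1 - 1 / real N) * (1 - 1 / real N) ^ K"
      using Suc.prems(2) by (intro mult_right_mono) auto
    also have "\<dots> < 1" using Suc.prems(3) by (simp add: mult.assoc)
    finally have "real (card (Y - I)) * (1 - 1 / real N) ^ K < 1" .
    moreover have "\<exists>I\<subseteq>Q. card Q \<le> N * card I \<and> (\<forall>h\<in>\<H>. h \<inter> Q \<subseteq> I \<longrightarrow> card (h \<inter> Q) \<le> 1)"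
      if "Q \<subseteq> Y - I" "Q \<noteq> {}" for Q
      using Suc.prems(4)[of Q] that by blast
    ultimately have "\<exists>c :: 'a \<Rightarrow> nat. (\<forall>y\<in>Y - I. c y < K) \<and>
        (\<forall>h\<in>\<H>. h \<inter> (Y - I) \<noteq> {} \<longrightarrow> (\<exists>k. \<exists>!u. u \<in> h \<inter> (Y - I) \<and> c u = k))"
      using Suc.prems(1,2) by (intro Suc.IH) simp_all
    then obtain c :: "'a \<Rightarrow> nat" where c: "\<forall>y\<in>Y - I. c y < K"
      "\<forall>h\<in>\<H>. h \<inter> (Y - I) \<noteq> {} \<longrightarrow> (\<exists>k. \<exists>!u. u \<in> h \<inter> (Y - I) \<and> c u = k)"
      by (elim exE conjE) (rule that)
    \<comment> \<open>Colour \<open>K\<close> is fresh, as \<open>Y - I\<close> uses colours below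
      \<open>K\<close>. A hyperedge that meets \<open>Y - I\<close> keeps its unique colour; one
      that meets \<open>Y\<close> only in \<open>I\<close> has a single vertex in
      \<open>Y\<close>.\<close>
    define c' where "c' u = (if u \<in> I then K else c u)" for u
    have "\<exists>k. \<exists>!u. u \<in> h \<inter> Y \<and> c' u = k" if h: "h \<in> \<H>" "h \<inter> Y \<noteq> {}" for h
    proof (cases "h \<inter> (Y - I) = {}")
      case True
      then have "card (h \<inter> Y) \<le> 1" using I(3)[of h] h(1) by blast
      then have "card (h \<inter> Y) = 1"
        using h(2) Suc.prems(1) by (metis card_0_eq finite_Int le_neq_implies_less less_one)
      then obtain u where "h \<inter> Y = {u}" by (rule card_1_singletonE)
      then show ?thesis by (intro exI[of _ "c' u"] ex1I[of _ u]) auto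
    next
      case False
      then obtain k u where u: "u \<in> h \<inter> (Y - I)" "c u = k"
        "\<And>w. \<lbrakk>w \<in> h \<inter> (Y - I); c w = k\<rbrakk> \<Longrightarrow> w = u"
        using c(2)[rule_format, OF h(1) False] by blast
      have "k < K" using u(1,2) c(1) by blast
      show ?thesis
      proof (intro exI ex1I)
        show "u \<in> h \<inter> Y \<and> c' u = k" using u(1,2) unfolding c'_def by auto
        show "w = u" if "w \<in> h \<inter> Y \<and> c' w = k" for w
        proof (rule u(3))
          have "w \<notin> I" using that \<open>k < K\<close> unfolding c'_def by auto
          then show "w \<in> h \<inter> (Y - I)" "c w = k" using that unfolding c'_def by auto
        qed
      qed
    qed
    moreover have "\<forall>y\<in>Y. c' y < Suc K" using c(1) unfolding c'_def by (auto simp: less_Suc_eq)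
    ultimately show ?thesis by blast
  qed simp
qed

section \<open>Intervals with depths\<close>

text \<open>An element that is not the sole hit of any \<open>f v\<close> can be discarded without
  losing the hitting property; repeat until none is left.\<close>

lemma minimal_hitting_set:
  assumes "finite U" "\<And>v. v \<in> W \<Longrightarrow> f v \<inter> U \<noteq> {}"
  shows "\<exists>T\<subseteq>U. (\<forall>v\<in>W. f v \<inter> T \<noteq> {}) \<and> (\<forall>u\<in>T. \<exists>v\<in>W. f v \<inter> T = {u})"
  using assms
proof (induction U rule: finite_psubset_induct)
  case (psubset U)
  show ?case
  proof (cases "\<forall>u\<in>U. \<exists>v\<in>W. f v \<inter> U = {u}")
    case True
    then show ?thesis using psubset.prems by blast
  next
    case False
    then obtain u where u: "u \<in> U" "\<And>v. v \<in> W \<Longrightarrow> f v \<inter> U \<noteq> {u}" by blast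
    have "f v \<inter> (U - {u}) \<noteq> {}" if "v \<in> W" for v
      using psubset.prems[OF that] u(2)[OF that] by blast
    then have "\<exists>T\<subseteq>U - {u}. (\<forall>v\<in>W. f v \<inter> T \<noteq> {}) \<and> (\<forall>u\<in>T. \<exists>v\<in>W. f v \<inter> T = {u})"
      using u(1) by (intro psubset.IH) blast+
    then show ?thesis by blast
  qed
qed

text \<open>Positivity of \<open>X\<close> keeps 0, which every power of two divides, out of the
  intervals, so that \<open>level\<close> is well defined.\<close>

locale hook_system =
  fixes V :: "'a set" and X D R :: "'a \<Rightarrow> nat"
  assumes finite_V: "finite V"
    and inj_X: "inj_on X V" and inj_D: "inj_on D V"
    and X_pos: "u \<in> V \<Longrightarrow> 0 < X u" and X_le_R: "u \<in> V \<Longrightarrow> X u \<le> R u"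
begin

text \<open>The arm of \<open>u\<close> crosses the vertical segment of \<open>v\<close>; a larger
  \<open>D\<close> means a deeper shape.\<close>

definition hits :: "'a \<Rightarrow> 'a \<Rightarrow> bool" where
  "hits u v \<longleftrightarrow> u \<in> V \<and> v \<in> V \<and> X u < X v \<and> X v \<le> R u \<and> D u < D v"

definition adj :: "'a \<Rightarrow> 'a \<Rightarrow> bool" where
  "adj u v \<longleftrightarrow> hits u v \<or> hits v u"

definition independent :: "'a set \<Rightarrow> bool" where
  "independent Y \<longleftrightarrow> (\<forall>u\<in>Y. \<forall>w\<in>Y. \<not> hits u w)"

section \<open>Dyadic levels and midpoints\<close>

definition level :: "'a \<Rightarrow> nat" where
  "level u = (GREATEST l. \<exists>z\<in>{X u..R u}. 2 ^ l dvd z)"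

text \<open>The choice is in fact unique: by \<open>same_block\<close> and
  \<open>middle_by_block\<close> it is the midpoint of the block of length
  \<open>2 ^ Suc (level u)\<close> containing the interval.\<close>

definition middle :: "'a \<Rightarrow> nat" where
  "middle u = (SOME z. z \<in> {X u..R u} \<and> 2 ^ level u dvd z)"

lemma power_dvd_bound:
  assumes "u \<in> V" "z \<in> {X u..R u}" "2 ^ l dvd z"
  shows "2 ^ l \<le> R u"
proof -
  have "0 < z" using assms X_pos[of u] by auto
  then have "2 ^ l \<le> z" using assms(3) dvd_imp_le by blast
  then show ?thesis using assms(2) by auto
qed

lemma power_dvd_exponent_bound:
  assumes "u \<in> V" "z \<in> {X u..R u}" "2 ^ l dvd z"
  shows "l \<le> R u"
  using power_dvd_bound[OF assms] less_exp[of l] by linarith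

lemma level_props:
  assumes "u \<in> V"
  shows "\<exists>z\<in>{X u..R u}. 2 ^ level u dvd z"
    and "\<And>z l. \<lbrakk>z \<in> {X u..R u}; 2 ^ l dvd z\<rbrakk> \<Longrightarrow> l \<le> level u"
proof -
  let ?P = "\<lambda>l. \<exists>z\<in>{X u..R u}. 2 ^ l dvd z"
  have bound: "l \<le> R u" if "?P l" for l using that power_dvd_exponent_bound[OF assms] by blast
  have "?P 0" using X_le_R[OF assms] by auto
  then show "?P (level u)" unfolding level_def using bound by (rule GreatestI_nat)
  show "l \<le> level u" if "z \<in> {X u..R u}" "2 ^ l dvd z" for z l
    unfolding level_def using that bound by (intro Greatest_le_nat[of ?P l "R u"]) blast+
qed

lemma middle_props:
  assumes "u \<in> V"
  shows "X u \<le> middle u" "middle u \<le> R u" "2 ^ level u dvd middle u"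
proof -
  have "\<exists>z. z \<in> {X u..R u} \<and> 2 ^ level u dvd z" using level_props(1)[OF assms] by blast
  from someI_ex[OF this] show "X u \<le> middle u" "middle u \<le> R u" "2 ^ level u dvd middle u"
    unfolding middle_def by auto
qed

lemma power_level_le:
  assumes "u \<in> V" shows "2 ^ level u \<le> R u"
  using power_dvd_bound[OF assms, of "middle u"] middle_props[OF assms] by auto

text \<open>If the interval crossed a boundary between blocks of length \<open>2 ^ Suc l\<close>,
  that boundary would be a multiple of \<open>2 ^ Suc l\<close> inside it and force a level above
  \<open>l\<close>.\<close>

lemma same_block:
  assumes "u \<in> V" "level u \<le> l" "z \<in> {X u..R u}" "z' \<in> {X u..R u}"
  shows "z div 2 ^ Suc l = z' div 2 ^ Suc l"
proof -
  have aux: False if "z \<in> {X u..R u}" "z' \<in> {X u..R u}" "z div 2 ^ Suc l < z' div 2 ^ Suc l" for z z'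
  proof -
    let ?m = "z' div 2 ^ Suc l * 2 ^ Suc l"
    have "z < ?m" using that(3) by (metis div_less_iff_less_mult mult.commute zero_less_numeral zero_less_power)
    moreover have "?m \<le> z'" by (rule div_times_less_eq_dividend)
    ultimately have "?m \<in> {X u..R u}"
      using that(1,2) unfolding atLeastAtMost_iff by linarith
    then have "Suc l \<le> level u" using level_props(2)[OF assms(1), of ?m "Suc l"] by simp
    then show False using assms(2) by simp
  qed
  show ?thesis using aux[of z z'] aux[of z' z] assms(3,4) by (meson nat_neq_iff)
qed

text \<open>The cofactor of \<open>2 ^ level u\<close> is odd, as otherwise the level would be
  larger; an odd multiple of the half length is the centre of its block.\<close>

lemma middle_by_block:
  assumes "u \<in> V"
  shows "middle u = middle u div 2 ^ Suc (level u) * 2 ^ Suc (level u) + 2 ^ level u"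
proof -
  let ?l = "level u" and ?m = "middle u"
  obtain q where q: "?m = 2 ^ ?l * q" using middle_props(3)[OF assms] by (auto elim: dvdE)
  have "odd q"
  proof
    assume "even q"
    then have "2 ^ Suc ?l dvd ?m" unfolding q by (auto elim!: evenE)
    then show False using level_props(2)[OF assms, of ?m "Suc ?l"] middle_props[OF assms] by auto
  qed
  then obtain r where "q = 2 * r + 1" by (auto elim: oddE)
  then have m: "?m = r * 2 ^ Suc ?l + 2 ^ ?l" unfolding q by (simp add: algebra_simps)
  have "?m div 2 ^ Suc ?l = r" unfolding m by (subst div_mult_self3) auto
  then show ?thesis using m by simp
qed

lemma hits_meet:
  assumes "hits u v"
  shows "u \<in> V" "v \<in> V" "X v \<in> {X u..R u}" "X v \<in> {X v..R v}"
  using assms X_le_R[of v] unfolding hits_def by auto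

definition block :: "nat \<Rightarrow> 'a \<Rightarrow> nat" where
  "block l u = X u div 2 ^ Suc l"

lemma block_eq_if_hits:
  assumes "hits u v" "level u \<le> l" "level v \<le> l"
  shows "block l u = block l v"
  using same_block[of u l "X u" "X v"] assms hits_meet[OF assms(1)] unfolding block_def by auto

text \<open>A common midpoint is what makes vertices of equal level interchangeable: it lies in each
  of their intervals.\<close>

lemma middle_eq_if_block_eq:
  assumes "u \<in> V" "w \<in> V" "level u = l" "level w = l" "block l u = block l w"
  shows "middle u = middle w"
proof -
  have "middle u div 2 ^ Suc l = block l u" "middle w div 2 ^ Suc l = block l w"
    using same_block[of u l "X u" "middle u"] same_block[of w l "X w" "middle w"]
      assms middle_props[OF assms(1)] middle_props[OF assms(2)] X_le_R[OF assms(1)] X_le_R[OF assms(2)]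
    unfolding block_def by auto
  then show ?thesis using middle_by_block[OF assms(1)] middle_by_block[OF assms(2)] assms(3-5) by metis
qed

lemma middle_eq_if_hits:
  assumes "hits u v" "level u = level v"
  shows "middle u = middle v"
  using assms middle_eq_if_block_eq[of u v "level v"] block_eq_if_hits[of u v "level v"] hits_meet
  by auto

lemma middle_eq_if_common_target:
  assumes "hits u v" "hits w v" "level u = level w"
  shows "middle u = middle w"
proof (rule middle_eq_if_block_eq[where l = "level w"])
  have "X u div 2 ^ Suc (level w) = X v div 2 ^ Suc (level w)"
    using same_block[of u "level w" "X u" "X v"] assms hits_meet[OF assms(1)] by auto
  moreover have "X w div 2 ^ Suc (level w) = X v div 2 ^ Suc (level w)"
    using same_block[of w "level w" "X w" "X v"] hits_meet[OF assms(2)] by auto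
  ultimately show "block (level w) u = block (level w) w" unfolding block_def by simp
qed (use assms hits_meet in auto)

section \<open>Undominated vertices, bad vertices and the transversal\<close>

definition undominated :: "'a set" where
  "undominated = {u \<in> V. \<forall>w. hits w u \<longrightarrow> level w \<noteq> level u}"

text \<open>Climb: a vertex of the same level that hits \<open>u\<close> shares its midpoint, starts
  further left and is shallower, so it hits \<open>v\<close> as well. The depth decreases, so the
  climb ends.\<close>

lemma undominated_hitter:
  assumes "hits u v" "X v \<le> middle u"
  shows "\<exists>u'. hits u' v \<and> level u' = level u \<and> u' \<in> undominated \<and> X v \<le> middle u'"
  using assms
proof (induction "D u" arbitrary: u rule: less_induct)
  case less
  show ?case
  proof (cases "u \<in> undominated")
    case True
    then show ?thesis using less.prems by blast
  next
    case False
    then obtain w where w: "hits w u" "level w = level u"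
      using hits_meet[OF less.prems(1)] unfolding undominated_def by blast
    have m: "middle w = middle u" using middle_eq_if_hits[OF w] .
    have "hits w v" using w(1) less.prems m middle_props(2)[of w] unfolding hits_def by auto
    moreover have "D w < D u" using w(1) unfolding hits_def by auto
    ultimately show ?thesis using less.hyps[of w] less.prems m w(2) by auto
  qed
qed

definition bad :: "'a set" where
  "bad = {v \<in> V. \<forall>u. adj u v \<longrightarrow> level u < level v}"

lemma bad_independent:
  assumes "v \<in> bad" "v' \<in> bad" shows "\<not> hits v v'"
  using assms unfolding bad_def adj_def by (auto dest: less_asym)

text \<open>Targets beyond the midpoint are left out so that any other vertex with the same midpoint
  also extends far enough to the right to reach the remaining ones.\<close>

definition near :: "'a \<Rightarrow> 'a set" where
  "near v = {u. hits u v \<or> hits v u \<and> X u \<le> middle v}"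

definition transversal :: "'a set" where
  "transversal = (SOME T. T \<subseteq> V \<and> (\<forall>v\<in>{v \<in> bad. near v \<noteq> {}}. near v \<inter> T \<noteq> {}) \<and>
     (\<forall>u\<in>T. \<exists>v\<in>{v \<in> bad. near v \<noteq> {}}. near v \<inter> T = {u}))"

lemma transversal:
  shows transversal_subset: "transversal \<subseteq> V"
    and transversal_hits: "\<And>v. \<lbrakk>v \<in> bad; near v \<noteq> {}\<rbrakk> \<Longrightarrow> near v \<inter> transversal \<noteq> {}"
    and transversal_private: "\<And>u. u \<in> transversal \<Longrightarrow> \<exists>v\<in>bad. near v \<inter> transversal = {u}"
proof -
  have "near v \<subseteq> V" for v unfolding near_def hits_def by auto
  then have "\<exists>T\<subseteq>V. (\<forall>v\<in>{v \<in> bad. near v \<noteq> {}}. near v \<inter> T \<noteq> {}) \<and>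
     (\<forall>u\<in>T. \<exists>v\<in>{v \<in> bad. near v \<noteq> {}}. near v \<inter> T = {u})"
    by (intro minimal_hitting_set finite_V) blast
  then have *: "transversal \<subseteq> V \<and>
     (\<forall>v\<in>{v \<in> bad. near v \<noteq> {}}. near v \<inter> transversal \<noteq> {}) \<and>
     (\<forall>u\<in>transversal. \<exists>v\<in>{v \<in> bad. near v \<noteq> {}}. near v \<inter> transversal = {u})"
    unfolding transversal_def by (rule someI_ex)
  then show "transversal \<subseteq> V" by blast
  show "near v \<inter> transversal \<noteq> {}" if "v \<in> bad" "near v \<noteq> {}" for v using * that by blast
  show "\<exists>v\<in>bad. near v \<inter> transversal = {u}" if "u \<in> transversal" for u using * that by blast
qed

section \<open>Private witnesses and the sorting into classes\<close>

definition witness :: "'a \<Rightarrow> 'a" where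
  "witness u = (SOME v. v \<in> bad \<and> near v \<inter> transversal = {u})"

lemma witness:
  assumes "u \<in> transversal"
  shows "witness u \<in> bad" "near (witness u) \<inter> transversal = {u}"
proof -
  have "\<exists>v. v \<in> bad \<and> near v \<inter> transversal = {u}" using transversal_private[OF assms] by blast
  from someI_ex[OF this] show "witness u \<in> bad" "near (witness u) \<inter> transversal = {u}"
    unfolding witness_def by auto
qed

text \<open>Kind 3 marks the vertices outside the transversal, whose witness is arbitrary.\<close>

definition kind :: "'a \<Rightarrow> nat" where
  "kind u = (if u \<notin> transversal then 3 else if hits (witness u) u then 2
     else if X (witness u) \<le> middle u then 0 else 1)"

text \<open>The flag is there for vertices \<open>v\<close> that are not bad, the last two entries
  for bad ones; the level serves both. Kind 3 keeps the default 0 apart from a genuine witness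
  level.\<close>

definition sort_of :: "'a \<Rightarrow> nat \<times> bool \<times> nat \<times> nat" where
  "sort_of u = (level u, u \<in> undominated, if u \<in> transversal then level (witness u) else 0, kind u)"

lemma kind_cases:
  assumes "u \<in> transversal"
  obtains "kind u = 0" "hits u (witness u)" "X (witness u) \<le> middle u"
    | "kind u = 1" "hits u (witness u)" "middle u < X (witness u)"
    | "kind u = 2" "hits (witness u) u" "X u \<le> middle (witness u)"
proof -
  have "u \<in> near (witness u)" using witness(2)[OF assms] by blast
  then show ?thesis using assms that unfolding near_def kind_def hits_def
    by (cases "X (witness u) \<le> middle u") (auto split: if_splits)
qed

lemma level_lt_witness:
  assumes "u \<in> transversal" shows "level u < level (witness u)"
proof -
  have "u \<in> near (witness u)" using witness(2)[OF assms] by blast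
  then show ?thesis using witness(1)[OF assms] unfolding near_def bad_def adj_def by auto
qed

lemma block_eq_witness:
  assumes "u \<in> transversal"
  shows "block (level (witness u)) u = block (level (witness u)) (witness u)"
  using level_lt_witness[OF assms]
  by (cases rule: kind_cases[OF assms]) (auto dest: block_eq_if_hits[where l = "level (witness u)"])

text \<open>If \<open>u\<close> hits \<open>w\<close>, their equal level gives them a common
  midpoint; the witnesses share one too, as all four vertices lie in one block at the level of the
  witnesses. Each kind then yields a second transversal vertex near a witness or two adjacent bad
  vertices.\<close>

lemma sort_independent:
  assumes u: "u \<in> transversal" and w: "w \<in> transversal" and eq: "sort_of u = sort_of w"
  shows "\<not> hits u w"
proof
  assume h: "hits u w"
  have lev: "level u = level w" and wlev: "level (witness u) = level (witness w)"
    and kind: "kind u = kind w" using eq u w unfolding sort_of_def by auto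
  have V: "u \<in> V" "w \<in> V" using hits_meet h by auto
  have ne: "u \<noteq> w" using h unfolding hits_def by auto
  have p: "middle u = middle w" using middle_eq_if_hits[OF h lev] .
  let ?j = "level (witness w)"
  have wV: "witness u \<in> V" "witness w \<in> V" using witness(1) u w unfolding bad_def by auto
  have "block ?j u = block ?j w"
    using block_eq_if_hits[OF h] level_lt_witness[OF u] level_lt_witness[OF w] wlev by auto
  then have "block ?j (witness u) = block ?j (witness w)"
    using block_eq_witness[OF u] block_eq_witness[OF w] wlev by simp
  then have m: "middle (witness u) = middle (witness w)"
    using middle_eq_if_block_eq[OF wV wlev] by blast
  have nu: "w \<notin> near (witness u)" using witness(2)[OF u] w ne by auto
  have nw: "u \<notin> near (witness w)" using witness(2)[OF w] u ne by auto
  note mu = middle_props[OF V(1)] and mw = middle_props[OF V(2)]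
    and mwu = middle_props[OF wV(1)] and mww = middle_props[OF wV(2)]
  show False
  proof (cases rule: kind_cases[OF w])
    case 1
    \<comment> \<open>The witness of \<open>w\<close> starts no later than the midpoint common to
      \<open>u\<close> and \<open>w\<close>, so \<open>u\<close> reaches it as well.\<close>
    have "hits u (witness w)" using 1 h p mu(2) unfolding hits_def by auto
    then show False using nw unfolding near_def by blast
  next
    case 2
    have u2: "hits u (witness u)" "middle u < X (witness u)"
      using 2(1) kind by (cases rule: kind_cases[OF u], auto)+
    \<comment> \<open>Both witnesses lie right of the common midpoint, and this puts that of
      \<open>u\<close> further left. If it is at least as deep as the other, \<open>w\<close> hits
      it; otherwise it hits the other through the midpoint shared by the witnesses.\<close>
    have "R u < X (witness w)"
    proof (rule ccontr)
      assume "\<not> ?thesis"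
      then have "hits u (witness w)" using 2 h unfolding hits_def by auto
      then show False using nw unfolding near_def by blast
    qed
    then have lt: "X (witness u) < X (witness w)" using u2 unfolding hits_def by auto
    have "D (witness u) < D (witness w)"
    proof (rule ccontr)
      assume "\<not> ?thesis"
      then have "hits w (witness u)" using 2 u2 lt p mw(1) unfolding hits_def by auto
      then show False using nu unfolding near_def by blast
    qed
    then have "hits (witness u) (witness w)" using lt wV m mwu(2) mww(1) unfolding hits_def by auto
    then show False using bad_independent witness(1) u w by blast
  next
    case 3
    have u3: "hits (witness u) u" "X u \<le> middle (witness u)"
      using 3(1) kind by (cases rule: kind_cases[OF u], auto)+
    \<comment> \<open>\<open>w\<close> starts no later than the midpoint shared by the witnesses, so
      the witness of \<open>u\<close> reaches it, and it is shallower than \<open>u\<close>, hence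
      than \<open>w\<close>.\<close>
    have "hits (witness u) w" using u3 3 h m mwu(2) unfolding hits_def by auto
    then show False using nu 3(3) m unfolding near_def by auto
  qed
qed

text \<open>For a bad \<open>v\<close> the sort of a near transversal vertex works, or that of any
  neighbour if none is near. Otherwise some neighbour has at least the level of \<open>v\<close>,
  and at that level all hitters of \<open>v\<close> share their midpoint with all targets of
  \<open>v\<close>.\<close>

lemma good_class:
  assumes v: "v \<in> V" and "adj u0 v"
  shows "\<exists>s. (\<exists>u. adj u v \<and> sort_of u = s) \<and>
    ((\<forall>u. hits u v \<longrightarrow> sort_of u \<noteq> s) \<or> (\<forall>u. hits v u \<longrightarrow> sort_of u \<noteq> s) \<or>
     v \<in> bad \<and> independent {u \<in> V. sort_of u = s})"
proof (cases "v \<in> bad")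
  case True
  show ?thesis
  proof (cases "near v = {}")
    case True
    then have "\<not> hits u v" for u unfolding near_def by auto
    then show ?thesis using assms(2) by blast
  next
    case False
    then obtain u where u: "u \<in> near v" "u \<in> transversal"
      using transversal_hits[OF True] by blast
    \<comment> \<open>Kind 3 occurs exactly outside the transversal, so the whole class of
      \<open>u\<close> lies in the transversal.\<close>
    have "w \<in> transversal" if "sort_of w = sort_of u" for w
      using that u(2) unfolding sort_of_def kind_def by (auto split: if_splits)
    then have "independent {w \<in> V. sort_of w = sort_of u}"
      unfolding independent_def using sort_independent by auto
    moreover have "adj u v" using u(1) unfolding near_def adj_def by auto
    ultimately show ?thesis using True by blast
  qed
next
  case False
  then obtain u where u: "adj u v" "level v \<le> level u"
    using v unfolding bad_def by (auto simp: not_less)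
  have middle_eq: "middle a = middle b" if "hits a v" "hits v b" "level a = level u" "level b = level u" for a b
  proof (rule middle_eq_if_block_eq[where l = "level u"])
    show "block (level u) a = block (level u) b"
      using block_eq_if_hits[OF that(1), of "level u"] block_eq_if_hits[OF that(2), of "level u"] that u(2)
      by simp
  qed (use that hits_meet in auto)
  show ?thesis
  proof (cases "\<exists>a. hits a v \<and> level a = level u \<and> X v \<le> middle a")
    case True
    then obtain a where a: "hits a v" "level a = level u" "a \<in> undominated" "X v \<le> middle a"
      using undominated_hitter by metis
    \<comment> \<open>A target \<open>b\<close> of this sort would share the midpoint of
      \<open>a\<close> and be hit by \<open>a\<close>, so it could not be undominated.\<close>
    have "sort_of b \<noteq> sort_of a" if b: "hits v b" for b
    proof
      assume "sort_of b = sort_of a"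
      then have b': "level b = level u" "b \<in> undominated" using a unfolding sort_of_def by auto
      have "middle a = middle b" using middle_eq a b b' by blast
      then have "hits a b" using a b middle_props[of a] middle_props[of b] unfolding hits_def by auto
      then show False using b' a(2) unfolding undominated_def by auto
    qed
    then show ?thesis using a(1) unfolding adj_def by blast
  next
    case False
    show ?thesis
    proof (cases "\<exists>a. hits a v \<and> level a = level u")
      case True
      then obtain a where a: "hits a v" "level a = level u" "middle a < X v"
        using False by (auto simp: not_le)
      \<comment> \<open>Such a \<open>b\<close> would start right of \<open>v\<close> and hence
        right of its own midpoint.\<close>
      have "sort_of b \<noteq> sort_of a" if b: "hits v b" for b
      proof
        assume "sort_of b = sort_of a"
        then have b': "level b = level u" using a unfolding sort_of_def by auto
        have "middle a = middle b" using middle_eq a b b' by blast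
        then show False using a b middle_props[of b] unfolding hits_def by auto
      qed
      then show ?thesis using a(1) unfolding adj_def by blast
    next
      case False
      then have "sort_of a \<noteq> sort_of u" if "hits a v" for a
        using that unfolding sort_of_def by auto
      then show ?thesis using u(1) by blast
    qed
  qed
qed

section \<open>Noncrossing pairs inside a class\<close>

definition node_key :: "'a \<Rightarrow> nat" where
  "node_key u = middle u * Suc (sum D V) + D u"

text \<open>\<open>Suc (sum D V)\<close> exceeds every depth, so the key is a numeral with the two
  digits midpoint and depth, ordered lexicographically.\<close>

lemma node_key_decode:
  assumes "u \<in> V"
  shows "node_key u div Suc (sum D V) = middle u" "node_key u mod Suc (sum D V) = D u"
proof -
  have "D u < Suc (sum D V)" using member_le_sum[of u V D] assms finite_V by simp
  then show "node_key u div Suc (sum D V) = middle u" "node_key u mod Suc (sum D V) = D u"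
    unfolding node_key_def by (subst div_mult_self3 mod_mult_self3; simp)+
qed

lemma inj_node_key: "inj_on node_key V"
  using node_key_decode(2) inj_D by (metis inj_on_def)

lemma node_key_between:
  assumes "a \<in> V" "b \<in> V" "z \<in> V" "middle a = middle b" "node_key a < node_key z" "node_key z < node_key b"
  shows "middle z = middle b" "D z < D b"
proof -
  have "middle a \<le> middle z" "middle z \<le> middle b"
    using div_le_mono[of "node_key a" "node_key z" "Suc (sum D V)"]
      div_le_mono[of "node_key z" "node_key b" "Suc (sum D V)"] assms node_key_decode(1) by auto
  then show *: "middle z = middle b" using assms(4) by simp
  show "D z < D b" using assms(6) * unfolding node_key_def by simp
qed

text \<open>A vertex of \<open>Q\<close> between two consecutive targets lies in the range of
  \<open>v\<close> without being hit, so it is no deeper than \<open>v\<close> and shallower than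
  both targets.\<close>

lemma visible_pair_of_targets:
  assumes "Q \<subseteq> V" "2 \<le> card ({u. hits v u} \<inter> Q)"
  obtains a b where "a \<in> {u. hits v u} \<inter> Q" "b \<in> {u. hits v u} \<inter> Q" "X a < X b"
    "visible Q X (\<lambda>u. int (D u)) a b"
proof -
  have "finite ({u. hits v u} \<inter> Q)" using assms(1) finite_V finite_subset by blast
  moreover have "inj_on X ({u. hits v u} \<inter> Q)" using inj_X assms(1) by (blast intro: inj_on_subset)
  ultimately obtain a b where ab: "a \<in> {u. hits v u} \<inter> Q" "b \<in> {u. hits v u} \<inter> Q" "X a < X b"
    "\<And>z. z \<in> {u. hits v u} \<inter> Q \<Longrightarrow> \<not> (X a < X z \<and> X z < X b)"
    using assms(2) by (rule two_lowest_keys) blast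
  have "D z < min (D a) (D b)" if "z \<in> Q" "X a < X z" "X z < X b" for z
  proof -
    have "\<not> hits v z" using ab(4)[of z] that by blast
    then show ?thesis using that ab(1,2) assms(1) unfolding hits_def by auto
  qed
  then have "visible Q X (\<lambda>u. int (D u)) a b" unfolding visible_def by auto
  then show ?thesis using that ab(1-3) by blast
qed

text \<open>All hitters in \<open>Q\<close> share a midpoint. A vertex of \<open>Q\<close> between
  two consecutive ones has it too and is shallower than \<open>v\<close>, so it misses
  \<open>v\<close> horizontally: it starts too late or ends too early, depending on the side of the
  midpoint where \<open>v\<close> lies.\<close>

lemma visible_pair_of_hitters:
  assumes "Q \<subseteq> V" "2 \<le> card ({u. hits u v} \<inter> Q)" and lev: "\<And>u w. \<lbrakk>u \<in> Q; w \<in> Q\<rbrakk> \<Longrightarrow> level u = level w"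
  obtains a b where "a \<in> {u. hits u v} \<inter> Q" "b \<in> {u. hits u v} \<inter> Q" "node_key a < node_key b"
    "visible Q node_key (\<lambda>u. int (R u)) a b \<or> visible Q node_key (\<lambda>u. - int (X u)) a b"
proof -
  have "finite ({u. hits u v} \<inter> Q)" using assms(1) finite_V finite_subset by blast
  moreover have "inj_on node_key ({u. hits u v} \<inter> Q)"
    using inj_node_key assms(1) by (blast intro: inj_on_subset)
  ultimately obtain a b where ab: "a \<in> {u. hits u v} \<inter> Q" "b \<in> {u. hits u v} \<inter> Q" "node_key a < node_key b"
    "\<And>z. z \<in> {u. hits u v} \<inter> Q \<Longrightarrow> \<not> (node_key a < node_key z \<and> node_key z < node_key b)"
    using assms(2) by (rule two_lowest_keys) blast
  have mid: "middle a = middle b" using middle_eq_if_common_target ab(1,2) lev by blast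
  have V: "a \<in> V" "b \<in> V" "v \<in> V" using ab(1,2) unfolding hits_def by auto
  have between: "\<not> hits z v" "middle z = middle b" "D z < D v" "z \<in> V" "X z \<le> middle z" "middle z \<le> R z"
    if z: "z \<in> Q" "node_key a < node_key z" "node_key z < node_key b" for z
  proof -
    show "\<not> hits z v" using ab(4)[of z] z by blast
    show zV: "z \<in> V" using z assms(1) by blast
    show "middle z = middle b" using node_key_between(1)[OF V(1,2) zV mid] z by blast
    have "D z < D b" using node_key_between(2)[OF V(1,2) zV mid] z by blast
    then show "D z < D v" using ab(2) unfolding hits_def by auto
    show "X z \<le> middle z" "middle z \<le> R z" using middle_props[OF zV] by auto
  qed
  have "visible Q node_key (\<lambda>u. int (R u)) a b \<or> visible Q node_key (\<lambda>u. - int (X u)) a b"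
  proof (cases "X v \<le> middle b")
    case True
    have "X a < X z" "X b < X z" if z: "z \<in> Q" "node_key a < node_key z" "node_key z < node_key b" for z
    proof -
      have "X v \<le> X z" using between[OF z] V True unfolding hits_def by auto
      then show "X a < X z" "X b < X z" using ab(1,2) unfolding hits_def by auto
    qed
    then have "visible Q node_key (\<lambda>u. - int (X u)) a b" unfolding visible_def by auto
    then show ?thesis ..
  next
    case False
    have "R z < R a" "R z < R b" if z: "z \<in> Q" "node_key a < node_key z" "node_key z < node_key b" for z
    proof -
      have "R z < X v" using between[OF z] V False unfolding hits_def by auto
      then show "R z < R a" "R z < R b" using ab(1,2) unfolding hits_def by auto
    qed
    then have "visible Q node_key (\<lambda>u. int (R u)) a b" unfolding visible_def by auto
    then show ?thesis ..
  qed
  then show ?thesis using that ab(1-3) by blast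
qed

text \<open>Covers the mixed two-element neighbourhoods, one hitter and one target; by
  \<open>favourable\<close> these arise only for bad \<open>v\<close> and an independent
  class.\<close>

definition linked :: "'a set \<Rightarrow> 'a \<Rightarrow> 'a \<Rightarrow> bool" where
  "linked Q u w \<longleftrightarrow> independent Q \<and> (\<exists>v\<in>bad. hits u v \<and> hits v w \<and> {x. adj x v} \<inter> Q = {u, w})"

text \<open>Three exclusions are played off against each other: \<open>Q\<close> is independent, bad
  vertices are not adjacent, and \<open>v\<close>, \<open>v'\<close> have no neighbours in
  \<open>Q\<close> beyond their pairs. The cases follow the column order of \<open>u'\<close> and
  \<open>v\<close>, then of \<open>w\<close> and \<open>v'\<close>.\<close>

lemma linked_noncrossing:
  assumes "Q \<subseteq> V" "u \<in> Q" "u' \<in> Q" "w \<in> Q" "w' \<in> Q"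
    and X: "X u < X u'" "X u' < X w" "X w < X w'"
    and "linked Q u w" "linked Q u' w'"
  shows False
proof -
  obtain v where v: "v \<in> bad" "hits u v" "hits v w" "{x. adj x v} \<inter> Q = {u, w}"
    using assms unfolding linked_def by blast
  obtain v' where v': "v' \<in> bad" "hits u' v'" "hits v' w'" "{x. adj x v'} \<inter> Q = {u', w'}"
    using assms unfolding linked_def by blast
  have indep: "\<not> hits a b" if "a \<in> Q" "b \<in> Q" for a b
    using assms that unfolding linked_def independent_def by blast
  have V: "u \<in> V" "u' \<in> V" "w \<in> V" "w' \<in> V" "v \<in> V" "v' \<in> V"
    using v v' assms unfolding bad_def by auto
  have "u' \<notin> {u, w}" "u \<notin> {u', w'}" "w \<notin> {u', w'}" using X by auto
  then have nadj: "\<not> adj u' v" "\<not> adj u v'" "\<not> adj w v'" using v(4) v'(4) assms(2-5) by blast+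
  have vv: "\<not> hits v v'" "\<not> hits v' v" using bad_independent v(1) v'(1) by auto
  have "u' \<noteq> v"
  proof
    assume "u' = v"
    then show False using v'(2) vv by blast
  qed
  then have "X u' \<noteq> X v" using inj_X V by (auto dest: inj_onD)
  then consider "X u' < X v" | "X v < X u'" by linarith
  then show False
  proof cases
    case 1
    \<comment> \<open>Otherwise \<open>u'\<close> misses \<open>v\<close> only by being at least as
      deep, and then \<open>u\<close> hits \<open>u'\<close>.\<close>
    have "R u' < X v"
    proof (rule ccontr)
      assume "\<not> ?thesis"
      then have "D v \<le> D u'" using nadj(1) 1 V unfolding adj_def hits_def by auto
      then have "hits u u'" using v(2) 1 X V unfolding hits_def by auto
      then show False using indep assms by blast
    qed
    then have "X v' < X v" using v'(2) unfolding hits_def by auto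
    moreover have "X v \<le> R v'" using X v'(3) v(3) unfolding hits_def by auto
    ultimately have "D v \<le> D v'" using vv V unfolding hits_def by auto
    then have "hits u v'" using v(2) v'(2) \<open>X v' < X v\<close> X V unfolding hits_def by auto
    then show False using nadj(2) unfolding adj_def by blast
  next
    case 2
    have u'v: "D u' \<le> D v" using nadj(1) 2 X V v(3) unfolding adj_def hits_def by auto
    have "w \<noteq> v'"
    proof
      assume "w = v'"
      then show False using v(3) vv by blast
    qed
    then have "X w \<noteq> X v'" using inj_X V by (auto dest: inj_onD)
    then consider "X v' < X w" | "X w < X v'" by linarith
    then show False
    proof cases
      case 1
      \<comment> \<open>\<open>v'\<close> is in the range of \<open>v\<close> and \<open>w\<close>
        in that of \<open>v'\<close>, but neither is hit there; so depths do not increase from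
        \<open>v\<close> to \<open>v'\<close> to \<open>w\<close>, although \<open>v\<close> hits
        \<open>w\<close>.\<close>
      then have "D v' \<le> D v" using vv(1) V v(3) v'(2) 2 unfolding hits_def by auto
      moreover have "D w \<le> D v'" using nadj(3) 1 X V v'(3) unfolding adj_def hits_def by auto
      ultimately show False using v(3) unfolding hits_def by auto
    next
      case 2
      then have "hits u' w" using v'(2) u'v v(3) X V unfolding hits_def by auto
      then show False using indep assms by blast
    qed
  qed
qed

definition favourable :: "nat \<times> bool \<times> nat \<times> nat \<Rightarrow> 'a \<Rightarrow> bool" where
  "favourable s v \<longleftrightarrow> (\<forall>u. hits u v \<longrightarrow> sort_of u \<noteq> s) \<or> (\<forall>u. hits v u \<longrightarrow> sort_of u \<noteq> s) \<or>
     v \<in> bad \<and> independent {u \<in> V. sort_of u = s}"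

text \<open>81 is \<open>3 ^ 4\<close>: one 3-colouring for pairs of targets, two for pairs of
  hitters, one for linked pairs. \<open>I\<close> is a colour class of at least average size; two
  neighbours of a favourable vertex with all its neighbours in \<open>Q\<close> inside
  \<open>I\<close> would yield a monochromatic edge.\<close>

lemma independent_part:
  assumes Q: "Q \<subseteq> {u \<in> V. sort_of u = s}"
  shows "\<exists>I\<subseteq>Q. card Q \<le> 81 * card I \<and>
    (\<forall>h\<in>{{u. adj u v} | v. favourable s v}. h \<inter> Q \<subseteq> I \<longrightarrow> card (h \<inter> Q) \<le> 1)"
proof -
  have QV: "Q \<subseteq> V" using Q by blast
  have fin: "finite Q" using QV finite_V finite_subset by blast
  have injX: "inj_on X Q" and injk: "inj_on node_key Q"
    using QV inj_X inj_node_key inj_on_subset by blast+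
  obtain f1 :: "'a \<Rightarrow> nat" where f1: "\<And>a. f1 a < 3"
    "\<And>a b. \<lbrakk>a \<in> Q; b \<in> Q; X a < X b; visible Q X (\<lambda>u. int (D u)) a b\<rbrakk> \<Longrightarrow> f1 a \<noteq> f1 b"
    using visible_three_coloring[OF fin injX] by metis
  obtain f2 :: "'a \<Rightarrow> nat" where f2: "\<And>a. f2 a < 3"
    "\<And>a b. \<lbrakk>a \<in> Q; b \<in> Q; node_key a < node_key b; visible Q node_key (\<lambda>u. int (R u)) a b\<rbrakk> \<Longrightarrow> f2 a \<noteq> f2 b"
    using visible_three_coloring[OF fin injk] by metis
  obtain f3 :: "'a \<Rightarrow> nat" where f3: "\<And>a. f3 a < 3"
    "\<And>a b. \<lbrakk>a \<in> Q; b \<in> Q; node_key a < node_key b; visible Q node_key (\<lambda>u. - int (X u)) a b\<rbrakk> \<Longrightarrow> f3 a \<noteq> f3 b"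
    using visible_three_coloring[OF fin injk] by metis
  have "\<exists>f :: 'a \<Rightarrow> nat. (\<forall>a. f a < 3) \<and> (\<forall>a\<in>Q. \<forall>b\<in>Q. X a < X b \<longrightarrow> linked Q a b \<longrightarrow> f a \<noteq> f b)"
    using fin injX by (rule noncrossing_three_coloring) (rule linked_noncrossing[OF QV])
  then obtain f4 :: "'a \<Rightarrow> nat" where f4: "\<And>a. f4 a < 3"
    "\<And>a b. \<lbrakk>a \<in> Q; b \<in> Q; X a < X b; linked Q a b\<rbrakk> \<Longrightarrow> f4 a \<noteq> f4 b"
    by metis
  define F where "F u = (f1 u, f2 u, f3 u, f4 u)" for u
  let ?C = "{..<3::nat} \<times> {..<3::nat} \<times> {..<3::nat} \<times> {..<3::nat}"
  have "F ` Q \<subseteq> ?C" using f1(1) f2(1) f3(1) f4(1) unfolding F_def by auto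
  then have "\<exists>c\<in>?C. card Q \<le> card ?C * card {q \<in> Q. F q = c}"
    by (intro large_fibre fin) (auto simp: lessThan_empty_iff)
  then obtain c where c: "card Q \<le> 81 * card {q \<in> Q. F q = c}" by auto
  define I where "I = {q \<in> Q. F q = c}"
  have "card ({u. adj u v} \<inter> Q) \<le> 1" if v: "favourable s v" and sub: "{u. adj u v} \<inter> Q \<subseteq> I" for v
  proof -
    let ?in = "{u. hits u v} \<inter> Q" and ?out = "{u. hits v u} \<inter> Q"
    have split: "{u. adj u v} \<inter> Q = ?in \<union> ?out" unfolding adj_def by blast
    have same: "f1 a = f1 b" "f2 a = f2 b" "f3 a = f3 b" "f4 a = f4 b"
      if "a \<in> ?in \<union> ?out" "b \<in> ?in \<union> ?out" for a b
      using that sub unfolding split I_def F_def by auto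
    have out: "card ?out \<le> 1"
    proof (rule ccontr)
      assume "\<not> ?thesis"
      then have "2 \<le> card ?out" by simp
      with QV obtain a b where "a \<in> ?out" "b \<in> ?out" "X a < X b" "visible Q X (\<lambda>u. int (D u)) a b"
        by (rule visible_pair_of_targets)
      then show False using f1(2)[of a b] same(1)[of a b] by blast
    qed
    have "in": "card ?in \<le> 1"
    proof (rule ccontr)
      assume "\<not> ?thesis"
      then have "2 \<le> card ?in" by simp
      moreover have "level u = level w" if "u \<in> Q" "w \<in> Q" for u w
      proof -
        have "sort_of u = sort_of w" using that Q by auto
        then show ?thesis unfolding sort_of_def by simp
      qed
      ultimately obtain a b where "a \<in> ?in" "b \<in> ?in" "node_key a < node_key b"
        "visible Q node_key (\<lambda>u. int (R u)) a b \<or> visible Q node_key (\<lambda>u. - int (X u)) a b"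
        by (rule visible_pair_of_hitters[OF QV])
      then show False using f2(2)[of a b] f3(2)[of a b] same(2,3)[of a b] by blast
    qed
    show ?thesis
    proof (cases "?in = {} \<or> ?out = {}")
      case True
      then show ?thesis using out "in" unfolding split by auto
    next
      case False
      \<comment> \<open>\<open>v\<close> has both a hitter and a target in the class, which leaves
        only the third alternative of \<open>favourable\<close>.\<close>
      then have bad: "v \<in> bad" and "independent {u \<in> V. sort_of u = s}"
        using v Q unfolding favourable_def by auto
      then have indep: "independent Q" using Q unfolding independent_def by blast
      obtain a where a: "?in = {a}"
        using False "in" fin by (metis card_1_singletonE card_0_eq finite_Int le_antisym less_one linorder_not_less)
      obtain b where b: "?out = {b}"
        using False out fin by (metis card_1_singletonE card_0_eq finite_Int le_antisym less_one linorder_not_less)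
      have ab: "a \<in> ?in" "b \<in> ?out" using a b by simp_all
      have "{u. adj u v} \<inter> Q = {a, b}" unfolding split using a b by auto
      then have "linked Q a b" using bad indep ab unfolding linked_def by blast
      moreover have "X a < X b" using ab unfolding hits_def by simp
      moreover have "f4 a = f4 b" using same(4)[of a b] ab by simp
      ultimately show ?thesis using f4(2)[of a b] ab by simp
    qed
  qed
  then show ?thesis using c by (intro exI[of _ I]) (auto simp: I_def)
qed

section \<open>Colouring all classes at once\<close>

lemma polylog_coloring:
  assumes K: "real (card V) * (80 / 81) ^ K < 1" and L: "\<And>u. u \<in> V \<Longrightarrow> level u \<le> L"
  shows "\<exists>C :: 'a \<Rightarrow> (nat \<times> bool \<times> nat \<times> nat) \<times> nat.
    C ` V \<subseteq> ({..L} \<times> UNIV \<times> {..L} \<times> {..3}) \<times> {..<K} \<and>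
    (\<forall>v\<in>V. {u. adj u v} \<noteq> {} \<longrightarrow> (\<exists>k. \<exists>!u. adj u v \<and> C u = k))"
proof -
  define served where "served s c \<longleftrightarrow> (\<forall>y\<in>{u \<in> V. sort_of u = s}. c y < K) \<and>
    (\<forall>h\<in>{{u. adj u v} | v. favourable s v}. h \<inter> {u \<in> V. sort_of u = s} \<noteq> {} \<longrightarrow>
       (\<exists>k. \<exists>!u. u \<in> h \<inter> {u \<in> V. sort_of u = s} \<and> c u = k))" for s and c :: "'a \<Rightarrow> nat"
  have "\<exists>c. served s c" for s
    unfolding served_def
  proof (rule conflict_free_by_independent_parts[where N = 81])
    show "finite {u \<in> V. sort_of u = s}" using finite_V by simp
    have "card {u \<in> V. sort_of u = s} \<le> card V" using finite_V by (intro card_mono) auto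
    then have "real (card {u \<in> V. sort_of u = s}) * (80 / 81) ^ K \<le> real (card V) * (80 / 81) ^ K"
      by (intro mult_right_mono) auto
    then have "real (card {u \<in> V. sort_of u = s}) * (80 / 81) ^ K < 1" using K by (rule le_less_trans)
    then show "real (card {u \<in> V. sort_of u = s}) * (1 - 1 / real 81) ^ K < 1" by simp
  qed (rule zero_less_numeral, rule independent_part)
  then obtain c where served: "\<And>s. served s (c s)" by metis
  note c = served[unfolded served_def, THEN conjunct1] served[unfolded served_def, THEN conjunct2]
  \<comment> \<open>The sort is part of the colour, so a colour unique among the neighbours in one
    class is unique in the whole neighbourhood.\<close>
  define C where "C u = (sort_of u, c (sort_of u) u)" for u
  have "C u \<in> ({..L} \<times> UNIV \<times> {..L} \<times> {..3}) \<times> {..<K}" if u: "u \<in> V" for u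
  proof -
    have "level (witness u) \<le> L" if "u \<in> transversal"
      using witness(1)[OF that] L unfolding bad_def by blast
    then show ?thesis using c(1)[of "sort_of u"] L[OF u] u
      unfolding C_def by (auto simp: sort_of_def kind_def)
  qed
  moreover have "\<exists>k. \<exists>!u. adj u v \<and> C u = k" if v: "v \<in> V" "{u. adj u v} \<noteq> {}" for v
  proof -
    obtain s u0 where s: "adj u0 v" "sort_of u0 = s" "favourable s v"
      using good_class[OF v(1)] v(2) unfolding favourable_def by blast
    have inV: "u \<in> V" if "adj u v" for u using that unfolding adj_def hits_def by auto
    have ne: "{u. adj u v} \<inter> {u \<in> V. sort_of u = s} \<noteq> {}" using s inV by blast
    have "{u. adj u v} \<in> {{u. adj u v} | v. favourable s v}" using s(3) by blast
    from c(2)[rule_format, OF this ne] obtain k where "\<exists>!u. u \<in> {u. adj u v} \<inter> {u \<in> V. sort_of u = s} \<and> c s u = k" ..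
    moreover have "u \<in> {u. adj u v} \<inter> {u \<in> V. sort_of u = s} \<and> c s u = k \<longleftrightarrow> adj u v \<and> C u = (s, k)" for u
      using inV[of u] unfolding C_def by auto
    ultimately have "\<exists>!u. adj u v \<and> C u = (s, k)" by (simp only:)
    then show ?thesis ..
  qed
  ultimately show ?thesis by blast
qed

end

section \<open>Grounded L-shapes\<close>

lemma l_shapes_meet:
  assumes "y < h" "y' < h" "x < r" "x' < r'"
  shows "l_shape x y h r \<inter> l_shape x' y' h r' \<noteq> {} \<longleftrightarrow>
    x \<le> x' \<and> x' \<le> r \<and> y' \<le> y \<or> x' \<le> x \<and> x \<le> r' \<and> y \<le> y'"
proof
  assume "l_shape x y h r \<inter> l_shape x' y' h r' \<noteq> {}"
  then show "x \<le> x' \<and> x' \<le> r \<and> y' \<le> y \<or> x' \<le> x \<and> x \<le> r' \<and> y \<le> y'"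
    unfolding l_shape_def using assms by auto
next
  assume "x \<le> x' \<and> x' \<le> r \<and> y' \<le> y \<or> x' \<le> x \<and> x \<le> r' \<and> y \<le> y'"
  then have "(x', y) \<in> l_shape x y h r \<inter> l_shape x' y' h r' \<or> (x, y') \<in> l_shape x y h r \<inter> l_shape x' y' h r'"
    unfolding l_shape_def using assms by auto
  then show "l_shape x y h r \<inter> l_shape x' y' h r' \<noteq> {}" by blast
qed

text \<open>Coordinates of distinct shapes may coincide. Breaking ties in each coordinate by the
  other one and then by the right end makes both orders strict without changing which shapes
  meet.\<close>

lemma lexicographic_meet_iff:
  fixes x y r x' y' r' :: real
  assumes "x < r" "x' < r'"
  shows "((x', - y', r') < (x, - y, r) \<and> x \<le> r' \<and> (- y', x', r') < (- y, x, r) \<or>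
      (x, - y, r) < (x', - y', r') \<and> x' \<le> r \<and> (- y, x, r) < (- y', x', r')) \<longleftrightarrow>
    \<not> (x = x' \<and> y = y' \<and> r = r') \<and>
    (x \<le> x' \<and> x' \<le> r \<and> y' \<le> y \<or> x' \<le> x \<and> x \<le> r' \<and> y \<le> y')"
  using assms
  by (cases x x' rule: linorder_cases; cases y y' rule: linorder_cases; cases r r' rule: linorder_cases)
    (auto simp: less_prod_simp)

definition rank :: "'a set \<Rightarrow> ('a \<Rightarrow> 'b::linorder) \<Rightarrow> 'a \<Rightarrow> nat" where
  "rank F k S = card {T \<in> F. k T \<le> k S}"

lemma rank_less_iff:
  assumes "finite F" "S \<in> F" "T \<in> F"
  shows "rank F k S < rank F k T \<longleftrightarrow> k S < k T"
proof -
  have less: "rank F k S < rank F k T" if "k S < k T" "S \<in> F" "T \<in> F" for S T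
  proof -
    have "{U \<in> F. k U \<le> k S} \<subset> {U \<in> F. k U \<le> k T}" using that by force
    then show ?thesis unfolding rank_def using assms(1) by (intro psubset_card_mono) auto
  qed
  moreover have "rank F k S = rank F k T" if "k S = k T" using that unfolding rank_def by simp
  ultimately show ?thesis using assms by (metis less_asym less_irrefl neqE)
qed

lemma inj_on_rank:
  assumes "finite F" "inj_on k F" shows "inj_on (rank F k) F"
proof (rule inj_onI)
  fix S T assume "S \<in> F" "T \<in> F" "rank F k S = rank F k T"
  then have "k S = k T" using rank_less_iff[OF assms(1)] by (metis less_irrefl neqE)
  then show "S = T" using \<open>S \<in> F\<close> \<open>T \<in> F\<close> by (rule inj_onD[OF assms(2)])
qed

lemma cf_chromatic_number_upper:
  fixes F :: "(real \<times> real) set set"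
  assumes fin: "finite F" and grounded: "\<forall>S\<in>F. grounded_L_shape h S"
    and L: "card F < 2 ^ Suc L" and K: "real (card F) * (80 / 81) ^ K < 1"
  shows "cf_chromatic_number F (intersection_edges F) \<le> 8 * Suc L ^ 2 * K"
proof -
  have "\<forall>S. \<exists>x y r. S \<in> F \<longrightarrow> y < h \<and> x < r \<and> S = l_shape x y h r"
    using grounded unfolding grounded_L_shape_iff by metis
  then obtain px py pr where p: "\<And>S. S \<in> F \<Longrightarrow> py S < h" "\<And>S. S \<in> F \<Longrightarrow> px S < pr S"
    "\<And>S. S \<in> F \<Longrightarrow> S = l_shape (px S) (py S) h (pr S)" by metis
  define kX where "kX S = (px S, - py S, pr S)" for S
  define kD where "kD S = (- py S, px S, pr S)" for S
  \<comment> \<open>\<open>kX\<close> sorts by \<open>px\<close> first, so the shapes with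
    \<open>px T \<le> pr S\<close> occupy exactly the ranks from 1 to \<open>R S\<close>.\<close>
  define R where "R S = card {T \<in> F. px T \<le> pr S}" for S
  have eq: "S = T" if "S \<in> F" "T \<in> F" "px S = px T" "py S = py T" "pr S = pr T" for S T
    using p(3) that by metis
  have "inj_on kX F" "inj_on kD F"
    unfolding kX_def kD_def by (rule inj_onI, rule eq; simp)+
  note inj = inj_on_rank[OF fin this(1)] inj_on_rank[OF fin this(2)]
  have kX_le: "px T \<le> px S" if "kX T \<le> kX S" for S T
    using that unfolding kX_def by (auto simp: less_eq_prod_def)
  have reach: "rank F kX T \<le> R S \<longleftrightarrow> px T \<le> pr S" if "S \<in> F" "T \<in> F" for S T
  proof
    assume "px T \<le> pr S"
    then have "{U \<in> F. kX U \<le> kX T} \<subseteq> {U \<in> F. px U \<le> pr S}" using kX_le by force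
    then show "rank F kX T \<le> R S" unfolding rank_def R_def using fin by (intro card_mono) auto
  next
    assume le: "rank F kX T \<le> R S"
    show "px T \<le> pr S"
    proof (rule ccontr)
      assume gt: "\<not> ?thesis"
      have "{U \<in> F. px U \<le> pr S} \<subset> {U \<in> F. kX U \<le> kX T}"
        using gt that unfolding kX_def by (auto simp: less_eq_prod_def)
      then have "R S < rank F kX T" unfolding rank_def R_def using fin by (intro psubset_card_mono) auto
      then show False using le by simp
    qed
  qed
  interpret hook_system F "rank F kX" "rank F kD" R
  proof
    show "finite F" "inj_on (rank F kX) F" "inj_on (rank F kD) F" by fact+
    show "0 < rank F kX S" if "S \<in> F" for S
      unfolding rank_def using that fin by (auto simp: card_gt_0_iff)
    show "rank F kX S \<le> R S" if "S \<in> F" for S using reach[OF that that] p(2)[OF that] by simp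
  qed
  have hits: "hits S T \<longleftrightarrow> S \<in> F \<and> T \<in> F \<and> kX S < kX T \<and> px T \<le> pr S \<and> kD S < kD T" for S T
    unfolding hits_def using rank_less_iff[OF fin] reach by blast
  have adj: "adj T S \<longleftrightarrow> T \<in> F \<and> S \<in> F \<and> S \<noteq> T \<and> S \<inter> T \<noteq> {}" for S T
  proof (cases "S \<in> F \<and> T \<in> F")
    case True
    then have "S \<inter> T \<noteq> {} \<longleftrightarrow>
        px S \<le> px T \<and> px T \<le> pr S \<and> py T \<le> py S \<or> px T \<le> px S \<and> px S \<le> pr T \<and> py S \<le> py T"
      using l_shapes_meet[of "py S" h "py T" "px S" "pr S" "px T" "pr T"] p by metis
    moreover have "S = T \<longleftrightarrow> px S = px T \<and> py S = py T \<and> pr S = pr T" using eq True by metis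
    moreover have "adj T S \<longleftrightarrow> kX T < kX S \<and> px S \<le> pr T \<and> kD T < kD S \<or> kX S < kX T \<and> px T \<le> pr S \<and> kD S < kD T"
      using True unfolding adj_def hits by blast
    ultimately show ?thesis
      using True lexicographic_meet_iff[of "px S" "pr S" "px T" "pr T" "py T" "py S"] p(2)[of S] p(2)[of T]
      unfolding kX_def kD_def by presburger
  qed (auto simp: adj_def hits)
  have lev: "level S \<le> L" if "S \<in> F" for S
  proof -
    have "2 ^ level S \<le> R S" using power_level_le[OF that] .
    also have "\<dots> \<le> card F" unfolding R_def using fin by (intro card_mono) auto
    also have "\<dots> < 2 ^ Suc L" by (rule L)
    finally show ?thesis using power_strict_increasing_iff[of "2::nat" "level S" "Suc L"] by simp
  qed
  have "\<exists>C :: (real \<times> real) set \<Rightarrow> (nat \<times> bool \<times> nat \<times> nat) \<times> nat.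
    C ` F \<subseteq> ({..L} \<times> UNIV \<times> {..L} \<times> {..3}) \<times> {..<K} \<and>
    (\<forall>v\<in>F. {u. adj u v} \<noteq> {} \<longrightarrow> (\<exists>k. \<exists>!u. adj u v \<and> C u = k))"
    by (rule polylog_coloring[OF K lev])
  then obtain C :: "(real \<times> real) set \<Rightarrow> (nat \<times> bool \<times> nat \<times> nat) \<times> nat" where
    C: "C ` F \<subseteq> ({..L} \<times> UNIV \<times> {..L} \<times> {..3}) \<times> {..<K}"
      "\<forall>v\<in>F. {u. adj u v} \<noteq> {} \<longrightarrow> (\<exists>k. \<exists>!u. adj u v \<and> C u = k)"
    by (elim exE conjE) (rule that)
  obtain e :: "(nat \<times> bool \<times> nat \<times> nat) \<times> nat \<Rightarrow> nat" where e: "inj_on e (C ` F)"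
    using finite_imp_inj_to_nat_seg[of "C ` F"] fin by blast
  have nbh: "neighborhood (intersection_edges F) v = {u. adj u v}" for v
    unfolding neighborhood_intersection_edges by (auto simp: adj)
  have "cf_coloring F (intersection_edges F) (e \<circ> C)"
    unfolding cf_coloring_def nbh
  proof (intro ballI impI)
    fix v assume "v \<in> F" "{u. adj u v} \<noteq> {}"
    from C(2)[rule_format, OF this] obtain k where "\<exists>!u. adj u v \<and> C u = k" ..
    then obtain u where u: "adj u v \<and> C u = k" "\<forall>w. adj w v \<and> C w = k \<longrightarrow> w = u"
      by (elim ex1E) (rule that)
    show "\<exists>k. \<exists>!u. u \<in> {u. adj u v} \<and> (e \<circ> C) u = k"
    proof (intro exI ex1I)
      show "u \<in> {u. adj u v} \<and> (e \<circ> C) u = e (C u)" using u(1) by simp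
      fix w assume w: "w \<in> {u. adj u v} \<and> (e \<circ> C) w = e (C u)"
      then have "w \<in> F" "u \<in> F" using u(1) adj by auto
      then have "C w = C u" using w by (intro inj_onD[OF e]) auto
      then show "w = u" using u(1) w by (intro u(2)[rule_format]) simp
    qed
  qed
  then have "cf_chromatic_number F (intersection_edges F) \<le> card ((e \<circ> C) ` F)"
    by (rule cf_chromatic_number_le)
  also have "\<dots> = card (e ` (C ` F))" by (simp add: image_comp)
  also have "\<dots> = card (C ` F)" using e by (rule card_image)
  also have "\<dots> \<le> card (({..L} \<times> (UNIV :: bool set) \<times> {..L} \<times> {..3::nat}) \<times> {..<K})"
    using C(1) by (intro card_mono) auto
  \<comment> \<open>The factor 8 comes from two values of the flag and four kinds.\<close>
  also have "\<dots> = 8 * Suc L ^ 2 * K" by (simp add: card_cartesian_product power2_eq_square algebra_simps)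
  finally show ?thesis .
qed

section \<open>The cubic logarithmic upper bound\<close>

lemma exists_log_exponent:
  fixes a :: real
  assumes "1 < a" "2 \<le> n"
  shows "\<exists>k. real n < a ^ Suc k \<and> real (Suc k) \<le> (1 / ln a + 1 / ln 2) * ln (real n)"
proof -
  define t where "t = ln (real n) / ln a"
  define k where "k = nat \<lfloor>t\<rfloor>"
  have "ln a > 0" using assms by simp
  have "t \<ge> 0" unfolding t_def using assms by auto
  then have k: "t < real (Suc k)" "real k \<le> t" unfolding k_def by linarith+
  have "ln (real n) < real (Suc k) * ln a" using k(1) \<open>ln a > 0\<close> unfolding t_def by (simp add: field_simps)
  also have "\<dots> = ln (a ^ Suc k)" using assms by (subst ln_realpow) auto
  finally have "real n < a ^ Suc k" using assms by (subst (asm) ln_less_cancel_iff) auto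
  \<comment> \<open>For \<open>2 \<le> n\<close> this term absorbs the successor.\<close>
  moreover have "1 \<le> 1 / ln 2 * ln (real n)" using assms by (simp add: field_simps)
  then have "real (Suc k) \<le> t + 1 / ln 2 * ln (real n)" using k(2) by linarith
  then have "real (Suc k) \<le> (1 / ln a + 1 / ln 2) * ln (real n)"
    unfolding t_def by (simp add: distrib_right)
  ultimately show ?thesis by blast
qed

lemma max_cf_grounded_L_upper: "(\<lambda>n. real (max_cf_grounded_L h n)) \<in> O(\<lambda>n. ln (real n) ^ 3)"
proof -
  \<comment> \<open>In units of \<open>ln n\<close>, \<open>A\<close> bounds the number of levels
    and \<open>B\<close> the number of peeling rounds; 81/80 is the inverse of the shrinking factor
    80/81.\<close>
  define A B :: real where "A = 1 / ln 2 + 1 / ln 2" and "B = 1 / ln (81 / 80) + 1 / ln 2"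
  have "real (max_cf_grounded_L h n) \<le> 8 * A ^ 2 * B * ln (real n) ^ 3" if n: "2 \<le> n" for n
  proof -
    obtain L where L: "real n < 2 ^ Suc L" "real (Suc L) \<le> A * ln (real n)"
      using exists_log_exponent[of 2 n] n unfolding A_def by auto
    obtain k where k: "real n < (81 / 80) ^ Suc k" "real (Suc k) \<le> B * ln (real n)"
      using exists_log_exponent[of "81 / 80" n] n unfolding B_def by auto
    have "max_cf_grounded_L h n \<in> grounded_L_cf_values h n"
      unfolding max_cf_grounded_L_def
      using finite_grounded_L_cf_values grounded_L_cf_values_nonempty by (rule Max_in)
    then obtain F where F: "max_cf_grounded_L h n = cf_chromatic_number F (intersection_edges F)"
      "finite F" "card F \<le> n" "\<forall>S\<in>F. grounded_L_shape h S"
      unfolding grounded_L_cf_values_def by blast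
    have "real (card F) < 2 ^ Suc L" using F(3) L(1) by simp
    then have "card F < 2 ^ Suc L" by (metis of_nat_less_numeral_power_cancel_iff)
    moreover have "real (card F) * (80 / 81) ^ Suc k < 1"
    proof -
      have "real (card F) < (81 / 80) ^ Suc k" using F(3) k(1) by simp
      then have "real (card F) * (80 / 81) ^ Suc k < (81 / 80) ^ Suc k * (80 / 81) ^ Suc k"
        by (intro mult_strict_right_mono) auto
      also have "\<dots> = 1" by (simp flip: power_mult_distrib power_Suc)
      finally show ?thesis .
    qed
    ultimately have "max_cf_grounded_L h n \<le> 8 * Suc L ^ 2 * Suc k"
      unfolding F(1) by (rule cf_chromatic_number_upper[OF F(2,4)])
    then have "real (max_cf_grounded_L h n) \<le> real (8 * Suc L ^ 2 * Suc k)"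
      by (simp only: of_nat_le_iff)
    also have "\<dots> = 8 * real (Suc L) ^ 2 * real (Suc k)"
      by (simp only: of_nat_mult of_nat_power of_nat_numeral)
    also have "\<dots> \<le> 8 * (A * ln (real n)) ^ 2 * (B * ln (real n))"
      using L(2) k(2) by (intro mult_mono power_mono) auto
    also have "\<dots> = 8 * A ^ 2 * B * ln (real n) ^ 3"
      by (simp add: power2_eq_square power3_eq_cube)
    finally show ?thesis .
  qed
  then show ?thesis
    by (intro bigoI[of _ "8 * A ^ 2 * B"] eventually_mono[OF eventually_ge_at_top[of 2]]) auto
qed

section \<open>Lower bound\<close>

lemma dyadic_blocks_need_colors:
  fixes f :: "nat \<Rightarrow> nat"
  assumes "\<And>l j. Suc j * 2 ^ l \<le> 2 ^ H \<Longrightarrow> \<exists>k. \<exists>!i. i \<in> {j * 2 ^ l..<Suc j * 2 ^ l} \<and> f i = k"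
    and "Suc j * 2 ^ l \<le> 2 ^ H"
  shows "Suc l \<le> card (f ` {j * 2 ^ l..<Suc j * 2 ^ l})"
  using assms(2)
proof (induction l arbitrary: j)
  case 0
  then show ?case by simp
next
  case (Suc l)
  let ?B = "{j * 2 ^ Suc l..<Suc j * 2 ^ Suc l}"
  let ?Lo = "{2 * j * 2 ^ l..<Suc (2 * j) * 2 ^ l}" and ?Hi = "{Suc (2 * j) * 2 ^ l..<Suc (Suc (2 * j)) * 2 ^ l}"
  have "j * 2 ^ Suc l = 2 * j * 2 ^ l" "Suc j * 2 ^ Suc l = Suc (Suc (2 * j)) * 2 ^ l" by simp_all
  then have B: "?B = ?Lo \<union> ?Hi" by (simp only: ivl_disj_un_two(3) mult_le_mono1 lessI less_imp_le)
  have disj: "?Lo \<inter> ?Hi = {}" by auto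
  obtain k i where i: "i \<in> ?B" "f i = k" "\<forall>w. w \<in> ?B \<and> f w = k \<longrightarrow> w = i"
    using assms(1)[OF Suc.prems] by (elim exE ex1E) auto
  \<comment> \<open>\<open>C\<close> will be the half without \<open>i\<close>: it misses the colour
    \<open>k\<close> and has at least \<open>Suc l\<close> colours by induction.\<close>
  have step: "Suc (Suc l) \<le> card (f ` ?B)" if sub: "C \<subseteq> ?B" "i \<notin> C" and C: "Suc l \<le> card (f ` C)" for C
  proof -
    have fin: "finite C" using sub(1) finite_subset by blast
    have "k \<notin> f ` C" using i(3) sub by blast
    then have "Suc (card (f ` C)) = card (insert k (f ` C))" using fin by simp
    also have "insert k (f ` C) \<subseteq> f ` ?B" using i(1,2) sub(1) by blast
    then have "card (insert k (f ` C)) \<le> card (f ` ?B)" by (intro card_mono) simp_all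
    finally show ?thesis using C by linarith
  qed
  have le: "Suc (Suc (2 * j)) * 2 ^ l \<le> 2 ^ H" "Suc (2 * j) * 2 ^ l \<le> 2 ^ H"
    using Suc.prems by (simp_all add: algebra_simps)
  show ?case
  proof (cases "i \<in> ?Lo")
    case True
    then have "i \<notin> ?Hi" using disj by blast
    then show ?thesis using step[of ?Hi] B Suc.IH[OF le(1)] by blast
  next
    case False
    then show ?thesis using step[of ?Lo] B Suc.IH[OF le(2)] by blast
  qed
qed

section \<open>Posts and bars\<close>

definition post :: "real \<Rightarrow> nat \<Rightarrow> nat \<Rightarrow> (real \<times> real) set" where
  "post h H i = l_shape (real i) (h - real (H + 2)) h (real i + 1 / 4)"

text \<open>A bar over a longer block starts slightly further left and lies deeper than the bars over
  shorter blocks inside it, so that no two bars meet.\<close>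

definition bar :: "real \<Rightarrow> nat \<Rightarrow> nat \<times> nat \<Rightarrow> (real \<times> real) set" where
  "bar h H = (\<lambda>(l, j). l_shape (real (j * 2 ^ l) - real (l + 1) / (2 * real (H + 2))) (h - real (l + 1)) h
     (real (Suc j * 2 ^ l) - 1 / 2))"

text \<open>An offset below 1/2 starts the bar strictly between the first post of its block and the
  integer column before it.\<close>

lemma bar_offset:
  assumes "l \<le> H"
  shows "0 < real (l + 1) / (2 * real (H + 2))" "real (l + 1) / (2 * real (H + 2)) < 1 / 2"
  using assms by (auto simp: field_simps)

lemma bar_width:
  assumes "l \<le> H"
  shows "real (j * 2 ^ l) - real (l + 1) / (2 * real (H + 2)) < real (Suc j * 2 ^ l) - 1 / 2"
proof -
  have "1 \<le> (2::real) ^ l" by simp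
  moreover have "real (Suc j * 2 ^ l) = real (j * 2 ^ l) + 2 ^ l" by (simp add: algebra_simps)
  ultimately show ?thesis using bar_offset(1)[OF assms] by linarith
qed

lemma grounded_post: "grounded_L_shape h (post h H i)"
  unfolding grounded_L_shape_iff post_def
  by (intro exI[of _ "real i"] exI[of _ "h - real (H + 2)"] exI[of _ "real i + 1 / 4"]) auto

lemma grounded_bar: "l \<le> H \<Longrightarrow> grounded_L_shape h (bar h H (l, j))"
  unfolding grounded_L_shape_iff bar_def prod.case
  using bar_width[of l H j]
  by (intro exI[of _ "real (j * 2 ^ l) - real (l + 1) / (2 * real (H + 2))"] exI[of _ "h - real (l + 1)"]
      exI[of _ "real (Suc j * 2 ^ l) - 1 / 2"] conjI) auto

text \<open>Posts reach depth \<open>H + 2\<close>, below every bar, so only columns matter: the bar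
  runs from just before the first column of its block to half a unit before the column after the
  block.\<close>

lemma bar_meets_post:
  assumes "l \<le> H"
  shows "bar h H (l, j) \<inter> post h H i \<noteq> {} \<longleftrightarrow> i \<in> {j * 2 ^ l..<Suc j * 2 ^ l}"
proof -
  let ?e = "real (l + 1) / (2 * real (H + 2))"
  note e = bar_offset[OF assms]
  have "bar h H (l, j) \<inter> post h H i \<noteq> {} \<longleftrightarrow>
    real (j * 2 ^ l) - ?e \<le> real i \<and> real i \<le> real (Suc j * 2 ^ l) - 1 / 2"
    unfolding bar_def post_def prod.case
    using bar_width[OF assms, of j] assms by (subst l_shapes_meet) auto
  also have "\<dots> \<longleftrightarrow> j * 2 ^ l \<le> i \<and> i < Suc j * 2 ^ l"
    using e by linarith
  finally show ?thesis by simp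
qed

text \<open>The block of level \<open>l'\<close> starts inside the one of level
  \<open>l \<le> l'\<close>, and dyadic alignment makes them start together. The larger offset of
  the longer bar then contradicts \<open>le\<close> unless the levels agree.\<close>

lemma bars_meet_aux:
  assumes l: "l \<le> l'" "l' \<le> H"
    and le: "real (j * 2 ^ l) - real (l + 1) / (2 * real (H + 2)) \<le> real (j' * 2 ^ l') - real (l' + 1) / (2 * real (H + 2))"
    and reach: "real (j' * 2 ^ l') - real (l' + 1) / (2 * real (H + 2)) \<le> real (Suc j * 2 ^ l) - 1 / 2"
  shows "l = l' \<and> j = j'"
proof -
  have e: "real (l + 1) / (2 * real (H + 2)) \<le> real (l' + 1) / (2 * real (H + 2))"
    using l by (intro divide_right_mono) auto
  have "j * 2 ^ l \<le> j' * 2 ^ l'" using le e by linarith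
  moreover have "j' * 2 ^ l' < Suc j * 2 ^ l" using reach bar_offset(2)[OF l(2)] by linarith
  moreover have "(2::nat) ^ l' = 2 ^ (l' - l) * 2 ^ l" using l by (simp flip: power_add)
  ultimately have "j * 2 ^ l \<le> (j' * 2 ^ (l' - l)) * 2 ^ l" "(j' * 2 ^ (l' - l)) * 2 ^ l < Suc j * 2 ^ l"
    by (simp_all add: mult.assoc)
  then have "j \<le> j' * 2 ^ (l' - l)" "j' * 2 ^ (l' - l) < Suc j"
    by (metis mult_le_cancel2 zero_less_numeral zero_less_power, metis mult_less_cancel2)
  then have eq: "j = j' * 2 ^ (l' - l)" by linarith
  then have "j * 2 ^ l = j' * 2 ^ l'" using l by (simp add: mult.assoc flip: power_add)
  then have "real (l' + 1) / (2 * real (H + 2)) \<le> real (l + 1) / (2 * real (H + 2))" using le by simp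
  then have "l' \<le> l" by (simp add: divide_le_cancel)
  then show ?thesis using l eq by simp
qed

lemma bars_meet:
  assumes "l \<le> H" "l' \<le> H" "bar h H (l, j) \<inter> bar h H (l', j') \<noteq> {}"
  shows "bar h H (l, j) = bar h H (l', j')"
proof -
  let ?e = "\<lambda>l. real (l + 1) / (2 * real (H + 2))"
  have "real (j * 2 ^ l) - ?e l \<le> real (j' * 2 ^ l') - ?e l' \<and>
      real (j' * 2 ^ l') - ?e l' \<le> real (Suc j * 2 ^ l) - 1 / 2 \<and> h - real (l' + 1) \<le> h - real (l + 1) \<or>
    real (j' * 2 ^ l') - ?e l' \<le> real (j * 2 ^ l) - ?e l \<and>
      real (j * 2 ^ l) - ?e l \<le> real (Suc j' * 2 ^ l') - 1 / 2 \<and> h - real (l + 1) \<le> h - real (l' + 1)"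
    using assms(3) unfolding bar_def prod.case
    by (subst (asm) l_shapes_meet) (use bar_width[OF assms(1)] bar_width[OF assms(2)] in auto)
  then have "l = l' \<and> j = j'"
  proof
    assume "real (j * 2 ^ l) - ?e l \<le> real (j' * 2 ^ l') - ?e l' \<and>
      real (j' * 2 ^ l') - ?e l' \<le> real (Suc j * 2 ^ l) - 1 / 2 \<and> h - real (l' + 1) \<le> h - real (l + 1)"
    then show ?thesis using assms(2) by (intro bars_meet_aux) auto
  next
    assume "real (j' * 2 ^ l') - ?e l' \<le> real (j * 2 ^ l) - ?e l \<and>
      real (j * 2 ^ l) - ?e l \<le> real (Suc j' * 2 ^ l') - 1 / 2 \<and> h - real (l + 1) \<le> h - real (l' + 1)"
    then have "l' = l \<and> j' = j" using assms(1) by (intro bars_meet_aux) auto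
    then show ?thesis by simp
  qed
  then show ?thesis by simp
qed

lemma inj_post: "inj (post h H)"
proof (rule injI)
  fix i i' assume eq: "post h H i = post h H i'"
  have "(real i, h) \<in> post h H i" unfolding post_def l_shape_def by auto
  then have "(real i, h) \<in> post h H i'" using eq by simp
  then show "i = i'" unfolding post_def l_shape_def by auto
qed

text \<open>Letting \<open>j\<close> run to \<open>2 ^ H\<close> on every level keeps the index set
  a product, at the price of bars past the last post; the size stays polynomial in
  \<open>2 ^ H\<close>, as a logarithmic bound requires.\<close>

definition comb :: "real \<Rightarrow> nat \<Rightarrow> (real \<times> real) set set" where
  "comb h H = post h H ` {..<2 ^ H} \<union> bar h H ` ({..H} \<times> {..<2 ^ H})"

lemma finite_comb: "finite (comb h H)"
  unfolding comb_def by simp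

lemma card_comb: "card (comb h H) \<le> 2 ^ (2 * H + 1)"
proof -
  have "card (comb h H) \<le> card (post h H ` {..<2 ^ H}) + card (bar h H ` ({..H} \<times> {..<2 ^ H}))"
    unfolding comb_def by (rule card_Un_le)
  also have "\<dots> \<le> 2 ^ H + Suc H * 2 ^ H"
    using card_image_le[of "{..<2 ^ H}" "post h H"] card_image_le[of "{..H} \<times> {..<2 ^ H}" "bar h H"]
    by (simp add: card_cartesian_product)
  also have "\<dots> = Suc (Suc H) * 2 ^ H" by simp
  also have "\<dots> \<le> 2 ^ Suc H * 2 ^ H"
    using less_exp[of "Suc H"] by (intro mult_right_mono) auto
  also have "\<dots> = 2 ^ (2 * H + 1)" by (subst power_add[symmetric]) (simp add: mult_2)
  finally show ?thesis .
qed

lemma grounded_comb: "S \<in> comb h H \<Longrightarrow> grounded_L_shape h S"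
  unfolding comb_def using grounded_post grounded_bar by auto

lemma bar_in_comb:
  assumes "Suc j * 2 ^ l \<le> 2 ^ H"
  shows "l \<le> H" "bar h H (l, j) \<in> comb h H"
proof -
  have "1 * 2 ^ l \<le> Suc j * 2 ^ l" "Suc j * 1 \<le> Suc j * 2 ^ l" by (rule mult_le_mono; simp)+
  from this[THEN le_trans, OF assms] have "(2::nat) ^ l \<le> 2 ^ H" "j < 2 ^ H" by simp_all
  then show "l \<le> H" "bar h H (l, j) \<in> comb h H"
    unfolding comb_def by (auto simp: power_increasing_iff)
qed

lemma neighborhood_bar:
  assumes "Suc j * 2 ^ l \<le> 2 ^ H"
  shows "neighborhood (intersection_edges (comb h H)) (bar h H (l, j)) = post h H ` {j * 2 ^ l..<Suc j * 2 ^ l}"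
proof -
  note l = bar_in_comb(1)[OF assms] and mem = bar_in_comb(2)[OF assms, of h]
  have post_ne: "bar h H (l, j) \<noteq> post h H i" for i
  proof
    assume eq: "bar h H (l, j) = post h H i"
    have "(real i, h - real (H + 2)) \<in> post h H i" unfolding post_def l_shape_def by auto
    then have "(real i, h - real (H + 2)) \<in> bar h H (l, j)" using eq by simp
    then show False using l unfolding bar_def l_shape_def by auto
  qed
  show ?thesis
  proof (intro equalityI subsetI)
    fix S assume "S \<in> neighborhood (intersection_edges (comb h H)) (bar h H (l, j))"
    then have S: "S \<in> comb h H" "bar h H (l, j) \<noteq> S" "bar h H (l, j) \<inter> S \<noteq> {}"
      unfolding neighborhood_intersection_edges by auto
    show "S \<in> post h H ` {j * 2 ^ l..<Suc j * 2 ^ l}"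
    proof (cases "S \<in> post h H ` {..<2 ^ H}")
      case True
      then obtain i where i: "S = post h H i" by blast
      then have "i \<in> {j * 2 ^ l..<Suc j * 2 ^ l}" using S(3) bar_meets_post[OF l] by blast
      then show ?thesis using i by blast
    next
      case False
      then obtain l' j' where "l' \<le> H" "S = bar h H (l', j')" using S(1) unfolding comb_def by auto
      then show ?thesis using bars_meet[OF l] S by blast
    qed
  next
    fix S assume "S \<in> post h H ` {j * 2 ^ l..<Suc j * 2 ^ l}"
    then obtain i where i: "S = post h H i" "i \<in> {j * 2 ^ l..<Suc j * 2 ^ l}" by blast
    then have "i < 2 ^ H" using assms by auto
    then have "S \<in> comb h H" using i unfolding comb_def by auto
    then show "S \<in> neighborhood (intersection_edges (comb h H)) (bar h H (l, j))"
      using mem post_ne bar_meets_post[OF l] i unfolding neighborhood_intersection_edges by blast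
  qed
qed

text \<open>The neighbours of a bar are exactly the posts of its block, so the colours of the posts
  satisfy the hypothesis of \<open>dyadic_blocks_need_colors\<close>, applied to the block of all
  posts.\<close>

lemma cf_chromatic_number_comb: "Suc H \<le> cf_chromatic_number (comb h H) (intersection_edges (comb h H))"
proof -
  obtain c where c: "cf_coloring (comb h H) (intersection_edges (comb h H)) c"
    "card (c ` comb h H) = cf_chromatic_number (comb h H) (intersection_edges (comb h H))"
    using cf_chromatic_number_attained[OF finite_comb] by blast
  have "\<exists>k. \<exists>!i. i \<in> {j * 2 ^ l..<Suc j * 2 ^ l} \<and> (c \<circ> post h H) i = k" if lj: "Suc j * 2 ^ l \<le> 2 ^ H" for j l
  proof -
    let ?B = "{j * 2 ^ l..<Suc j * 2 ^ l}"
    note mem = bar_in_comb(2)[OF lj, of h]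
    have "post h H ` ?B \<noteq> {}" by auto
    with c(1) mem have "\<exists>k. \<exists>!u. u \<in> post h H ` ?B \<and> c u = k"
      unfolding cf_coloring_def using neighborhood_bar[OF lj] by metis
    then obtain k where "\<exists>!u. u \<in> post h H ` ?B \<and> c u = k" ..
    then obtain u where u: "u \<in> post h H ` ?B \<and> c u = k" "\<forall>w. w \<in> post h H ` ?B \<and> c w = k \<longrightarrow> w = u"
      by (elim ex1E) (rule that)
    then obtain i where i: "i \<in> ?B" "u = post h H i" by blast
    show ?thesis
    proof (intro exI ex1I)
      show "i \<in> ?B \<and> (c \<circ> post h H) i = k" using i u(1) by simp
      fix i' assume "i' \<in> ?B \<and> (c \<circ> post h H) i' = k"
      then have "post h H i' = u" using u(2) by simp
      then show "i' = i" using i inj_post by (auto dest: injD)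
    qed
  qed
  then have "Suc H \<le> card ((c \<circ> post h H) ` {0 * 2 ^ H..<Suc 0 * 2 ^ H})"
    by (rule dyadic_blocks_need_colors) auto
  also have "\<dots> \<le> card (c ` comb h H)"
    using finite_comb by (intro card_mono) (auto simp: comb_def)
  finally show ?thesis using c(2) by simp
qed

section \<open>The logarithmic lower bound\<close>

lemma max_cf_grounded_L_ge:
  assumes "2 ^ (2 * H + 1) \<le> n" shows "Suc H \<le> max_cf_grounded_L h n"
proof -
  have "cf_chromatic_number (comb h H) (intersection_edges (comb h H)) \<in> grounded_L_cf_values h n"
    unfolding grounded_L_cf_values_def using finite_comb card_comb[of h H] assms grounded_comb
    by (blast intro: le_trans)
  then have "cf_chromatic_number (comb h H) (intersection_edges (comb h H)) \<le> max_cf_grounded_L h n"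
    unfolding max_cf_grounded_L_def using finite_grounded_L_cf_values by (rule Max_ge[rotated])
  then show ?thesis using cf_chromatic_number_comb[of H h] by linarith
qed

lemma max_cf_grounded_L_lower: "(\<lambda>n. real (max_cf_grounded_L h n)) \<in> \<Omega>(\<lambda>n. ln (real n))"
proof -
  have "1 / (3 * ln 2) * ln (real n) \<le> real (max_cf_grounded_L h n)" if n: "2 \<le> n" for n
  proof -
    obtain m where m: "2 ^ m \<le> n" "n < 2 ^ (m + 1)"
      using ex_power_ivl1[of 2 n] n by auto
    \<comment> \<open>The largest \<open>H\<close> with \<open>2 * H + 1 \<le> m\<close>, so that
      the comb has at most \<open>n\<close> shapes; the factor 3 below is tight at
      \<open>m = 2\<close>.\<close>
    define H where "H = (m - 1) div 2"
    have "m \<noteq> 0" using m(2) n by (intro notI) simp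
    then have H: "2 * H + 1 \<le> m" "m + 1 \<le> 3 * Suc H" unfolding H_def by presburger+
    have "(2::nat) ^ (2 * H + 1) \<le> 2 ^ m" using H(1) by (intro power_increasing) auto
    then have "Suc H \<le> max_cf_grounded_L h n" using m(1) by (intro max_cf_grounded_L_ge) linarith
    moreover have "ln (real n) \<le> real (3 * Suc H) * ln 2"
    proof -
      have "real n \<le> 2 ^ (m + 1)" using m(2) by (metis of_nat_less_numeral_power_cancel_iff less_imp_le)
      also have "\<dots> \<le> 2 ^ (3 * Suc H)" using H(2) by (intro power_increasing) auto
      finally have "ln (real n) \<le> ln (2 ^ (3 * Suc H))" using n by (subst ln_le_cancel_iff) simp_all
      also have "\<dots> = real (3 * Suc H) * ln 2" by (rule ln_realpow)
      finally show ?thesis .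
    qed
    then have "1 / (3 * ln 2) * ln (real n) \<le> real (Suc H)" by (simp add: field_simps)
    ultimately show ?thesis by linarith
  qed
  then show ?thesis
    by (intro landau_omega.bigI[of "1 / (3 * ln 2)"] eventually_mono[OF eventually_ge_at_top[of 2]]) auto
qed

theorem theorem2:
  fixes h :: real
  shows "(\<lambda>n. real (max_cf_grounded_L h n)) \<in> \<Omega>(\<lambda>n. ln (real n))
       \<and> (\<lambda>n. real (max_cf_grounded_L h n)) \<in> O(\<lambda>n. ln (real n) ^ 3)"
  using max_cf_grounded_L_lower max_cf_grounded_L_upper by blast

end
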